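(* For every $\varepsilon>0$ there exists $n_0$ such that the Markov width of the complete graph $K_n$ on $n$ vertices satisfies $\mu(K_n)\ge n^{2-\varepsilon}$ for all $n\ge n_0$.
   Context: For a finite set $X$ with $|X|=n$, let $\mathcal{Z}(X)\simeq\mathbb{Z}^{2^n}$ denote the integral lattice (free abelian group) with orthonormal basis $\{e_a\}$ indexed by all binary labelings $a:X\to\{0,1\}$. A vector of $\mathcal{Z}(X)$ is non-negative if all its coordinates in this basis are non-negative, and $\|\cdot\|_1$ is the $\ell_1$-norm with respect to this basis. For $Y\subseteq X$, let $\pi_{Y}=\pi_{X\to Y}:\mathcal{Z}(X)\to\mathcal{Z}(Y)$ be the linear extension of the map $e_a\mapsto e_{a|_Y}$; write $\pi_{ij}$ for $\pi_{\{i,j\}}$. For a graph $G$, let $\pi_G$ be the linear map on $\mathcal{Z}(V(G))$ obtained as the product of the maps $\pi_{ij}$ over all edges $ij\in E(G)$, i.e. $\pi_G(z)=(\pi_{ij}(z))_{ij\in E(G)}$. A finite subset $B\subseteq\ker(\pi_G)$ is a Markov basis of $G$ if for all non-negative vectors $v_1,v_2\in\mathcal{Z}(V(G))$ with $\pi_G(v_1)=\pi_G(v_2)$ there exist $u_1,\ldots,u_\ell\in\pm B$ such that $v_1+\sum_{k=1}^{\ell}u_k=v_2$ and $v_1+\sum_{k=1}^{\ell'}u_k$ is non-negative for all $1\le\ell'\le\ell$. The Markov width $\mu(G)$ is the smallest integer $k$ such that there exists a Markov basis $B$ of $G$ with $\|v\|_1\le 2k$ for every $v\in B$. *)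

theory Defs
  imports Complex_Main "HOL-Library.FuncSet" "HOL-Library.Poly_Mapping"
begin

(* A graph is a pair (V, E) of a finite vertex set and a set of edges, each edge being a
   two-element subset {i, j} of V. *)
type_synonym 'v graph = "'v set \<times> 'v set set"

definition complete_graph :: "nat \<Rightarrow> nat graph" where
  "complete_graph n = ({..<n}, {{i, j} | i j. i < n \<and> j < n \<and> i \<noteq> j})"

(* Labelings are extensional functions: their value outside X is undefined. *)
definition labelings :: "'v set \<Rightarrow> ('v \<Rightarrow> nat) set" where
  "labelings X = (X \<rightarrow>\<^sub>E {0, 1})"

(* The basis vector e_a is frag_of a; the coordinate of z at e_a is lookup z a. *)
definition int_lattice :: "'v set \<Rightarrow> (('v \<Rightarrow> nat) \<Rightarrow>\<^sub>0 int) set" where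
  "int_lattice X = {z. Poly_Mapping.keys z \<subseteq> labelings X}"

definition nonneg :: "('b \<Rightarrow>\<^sub>0 int) \<Rightarrow> bool" where
  "nonneg z \<longleftrightarrow> (\<forall>a. 0 \<le> Poly_Mapping.lookup z a)"

definition l1_norm :: "('b \<Rightarrow>\<^sub>0 int) \<Rightarrow> int" where
  "l1_norm z = (\<Sum>a\<in>Poly_Mapping.keys z. \<bar>Poly_Mapping.lookup z a\<bar>)"

(* The source set X does not occur: on int_lattice X, with Y a subset of X, this is the map
   from int_lattice X to int_lattice Y. *)
definition proj :: "'v set \<Rightarrow> (('v \<Rightarrow> nat) \<Rightarrow>\<^sub>0 int) \<Rightarrow> (('v \<Rightarrow> nat) \<Rightarrow>\<^sub>0 int)" where
  "proj Y = frag_extend (\<lambda>a. frag_of (restrict a Y))"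

(* An element of the product over the edges is a family indexed by edges, set to 0 off E. *)
definition graph_proj ::
  "'v graph \<Rightarrow> (('v \<Rightarrow> nat) \<Rightarrow>\<^sub>0 int) \<Rightarrow> 'v set \<Rightarrow> (('v \<Rightarrow> nat) \<Rightarrow>\<^sub>0 int)" where
  "graph_proj G z = (\<lambda>e. if e \<in> snd G then proj e z else 0)"

definition graph_ker :: "'v graph \<Rightarrow> (('v \<Rightarrow> nat) \<Rightarrow>\<^sub>0 int) set" where
  "graph_ker G = {z \<in> int_lattice (fst G). graph_proj G z = (\<lambda>_. 0)}"

definition markov_basis :: "'v graph \<Rightarrow> (('v \<Rightarrow> nat) \<Rightarrow>\<^sub>0 int) set \<Rightarrow> bool" where
  "markov_basis G B \<longleftrightarrow>
     finite B \<and> B \<subseteq> graph_ker G \<and>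
     (\<forall>v1\<in>int_lattice (fst G). \<forall>v2\<in>int_lattice (fst G).
        nonneg v1 \<longrightarrow> nonneg v2 \<longrightarrow> graph_proj G v1 = graph_proj G v2 \<longrightarrow>
        (\<exists>us. set us \<subseteq> B \<union> uminus ` B \<and>
              v1 + sum_list us = v2 \<and>
              (\<forall>l\<in>{1..length us}. nonneg (v1 + sum_list (take l us)))))"

(* The minimum ranges over natural numbers; over all integers it would not exist when the
   empty set is a Markov basis. *)
definition markov_width :: "'v graph \<Rightarrow> nat" where
  "markov_width G =
     (LEAST k. \<exists>B. markov_basis G B \<and> (\<forall>v\<in>B. l1_norm v \<le> 2 * int k))"

end

theory Submission
  imports Defs
begin

text \<open>An element of the kernel of \<open>\<pi>\<^bsub>K\<^sub>n\<^esub>\<close> is a signed combination of 0/1-vectors whose pairwise moments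
  cancel. Take a tripartite graph on three copies of \<open>\<int>/N\<close> in which every edge lies in exactly two
  triangles, one positive and one negative. A non-negative vector with the same pair marginals as the
  sum of the positive triangles is supported on triangles, and around every edge the two coefficients
  of a kernel element cancel. If the triangles are connected through common edges, the kernel elements
  are then the multiples of a single vector, whose norm is the number of triangles.

  Such a dense graph is a variant of the Ruzsa--Szemeredi construction. For a cyclic sequence \<open>g\<close> of
  \<open>M\<close> residues, the triangles are \<open>(x, x - g k, x + g (k + 1))\<close> and \<open>(x, x - g (k + 1), x + g k)\<close>. The
  requirement on the edges is that \<open>g i + g j = g k + g (k + 1)\<close> only for \<open>{i, j} = {k, k + 1}\<close>. As in
  Behrend's construction this follows from convexity: \<open>g k\<close> encodes a point \<open>v\<close> of the grid
  \<open>{0..d-1}\<^sup>m\<close> together with \<open>\<bar>v\<bar>\<^sup>2\<close>, and consecutive points are neighbours in the grid. A Gray code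
  makes the cycle run through the whole grid, so that \<open>M\<close> is about \<open>d\<^sup>m\<close> with \<open>N\<close> about \<open>d\<^sup>m\<^sup>+\<^sup>2\<close>.\<close>

section \<open>Lattice vectors and the kernel\<close>

lemma finite_labelings: "finite X \<Longrightarrow> finite (labelings X)"
  unfolding labelings_def by (intro finite_PiE) auto

lemma keys_int_lattice: "z \<in> int_lattice X \<Longrightarrow> Poly_Mapping.keys z \<subseteq> labelings X"
  by (simp add: int_lattice_def)

lemma labelings_cases: "a \<in> labelings X \<Longrightarrow> i \<in> X \<Longrightarrow> a i = 0 \<or> a i = 1"
  by (auto simp: labelings_def PiE_def Pi_def)

lemma l1_norm_superset:
  assumes "finite S" "Poly_Mapping.keys z \<subseteq> S"
  shows "l1_norm z = (\<Sum>a\<in>S. \<bar>Poly_Mapping.lookup z a\<bar>)"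
  unfolding l1_norm_def using assms
  by (intro sum.mono_neutral_left) (auto simp: in_keys_iff)

lemma l1_norm_uminus: "l1_norm (- z) = l1_norm z"
  by (simp add: l1_norm_def)

lemma lookup_proj:
  assumes "finite S" "Poly_Mapping.keys z \<subseteq> S"
  shows "Poly_Mapping.lookup (proj Y z) b = (\<Sum>a\<in>{a\<in>S. restrict a Y = b}. Poly_Mapping.lookup z a)"
proof -
  have "Poly_Mapping.lookup (proj Y z) b =
      (\<Sum>a\<in>Poly_Mapping.keys z. Poly_Mapping.lookup z a * (if b = restrict a Y then 1 else 0))"
    by (simp add: proj_def frag_extend_def lookup_sum)
  also have "\<dots> = (\<Sum>a\<in>S. Poly_Mapping.lookup z a * (if b = restrict a Y then 1 else 0))"
    using assms by (intro sum.mono_neutral_left) (auto simp: in_keys_iff)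
  also have "\<dots> = (\<Sum>a\<in>S. if restrict a Y = b then Poly_Mapping.lookup z a else 0)"
    by (intro sum.cong) auto
  also have "\<dots> = (\<Sum>a\<in>{a\<in>S. restrict a Y = b}. Poly_Mapping.lookup z a)"
    using assms(1) by (simp add: sum.If_cases Int_def)
  finally show ?thesis .
qed

lemma graph_proj_eq_iff:
  "graph_proj G v = graph_proj G w \<longleftrightarrow> (\<forall>e\<in>snd G. proj e v = proj e w)"
  by (auto simp: graph_proj_def fun_eq_iff)

lemma graph_ker_iff:
  "z \<in> graph_ker G \<longleftrightarrow> z \<in> int_lattice (fst G) \<and> (\<forall>e\<in>snd G. proj e z = 0)"
  by (auto simp: graph_ker_def graph_proj_def fun_eq_iff)

lemma int_lattice_add: "v \<in> int_lattice X \<Longrightarrow> w \<in> int_lattice X \<Longrightarrow> v + w \<in> int_lattice X"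
  using keys_add[of v w] by (auto simp: int_lattice_def)

lemma int_lattice_diff: "v \<in> int_lattice X \<Longrightarrow> w \<in> int_lattice X \<Longrightarrow> v - w \<in> int_lattice X"
  using keys_diff[of v w] by (auto simp: int_lattice_def)

lemma graph_ker_0: "0 \<in> graph_ker G"
  by (simp add: graph_ker_iff int_lattice_def proj_def)

lemma graph_ker_diff: "v \<in> graph_ker G \<Longrightarrow> w \<in> graph_ker G \<Longrightarrow> v - w \<in> graph_ker G"
  by (simp add: graph_ker_iff int_lattice_diff proj_def frag_extend_diff)

lemma graph_ker_uminus: "v \<in> graph_ker G \<Longrightarrow> - v \<in> graph_ker G"
  using graph_ker_diff[OF graph_ker_0] by fastforce

lemma diff_in_graph_ker:
  assumes "v \<in> int_lattice (fst G)" "w \<in> int_lattice (fst G)" "graph_proj G v = graph_proj G w"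
  shows "w - v \<in> graph_ker G"
  using assms by (simp add: graph_ker_iff int_lattice_diff graph_proj_eq_iff proj_def frag_extend_diff)

text \<open>The weight factors through the restriction to \<open>{i, j}\<close>, so grouping
  labelings by their restriction turns the sum into a combination of coordinates of
  \<open>proj {i, j} z\<close>.\<close>

lemma graph_ker_pair_sum:
  fixes \<phi> :: "nat \<Rightarrow> nat \<Rightarrow> int"
  assumes z: "z \<in> graph_ker G" and fin: "finite (fst G)" and e: "{i, j} \<in> snd G"
  shows "(\<Sum>a\<in>labelings (fst G). Poly_Mapping.lookup z a * \<phi> (a i) (a j)) = 0"
proof -
  let ?S = "labelings (fst G)" and ?r = "\<lambda>a. restrict a {i, j}"
  note fS = finite_labelings[OF fin]
  have ks: "Poly_Mapping.keys z \<subseteq> ?S" and p0: "proj {i, j} z = 0"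
    using z e by (auto simp: graph_ker_iff keys_int_lattice)
  have "(\<Sum>a\<in>?S. Poly_Mapping.lookup z a * \<phi> (a i) (a j)) =
      (\<Sum>b\<in>?r ` ?S. \<Sum>a\<in>{a\<in>?S. ?r a = b}. Poly_Mapping.lookup z a * \<phi> (a i) (a j))"
    by (rule sum.image_gen[OF fS])
  also have "\<dots> = (\<Sum>b\<in>?r ` ?S. (\<Sum>a\<in>{a\<in>?S. ?r a = b}. Poly_Mapping.lookup z a) * \<phi> (b i) (b j))"
    unfolding sum_distrib_right by (intro sum.cong refl) auto
  also have "\<dots> = 0"
    by (simp flip: lookup_proj[OF fS ks] add: p0)
  finally show ?thesis .
qed

section \<open>Existence of a finite Markov basis\<close>

lemma nat_seq_mono_subseq:
  fixes s :: "nat \<Rightarrow> nat"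
  shows "\<exists>f :: nat \<Rightarrow> nat. strict_mono f \<and> mono (\<lambda>n. s (f n))"
proof -
  obtain f where f: "strict_mono f" "monoseq (\<lambda>n. s (f n))"
    using seq_monosub by blast
  show ?thesis
  proof (cases "mono (\<lambda>n. s (f n))")
    case False
    then have dec: "antimono (\<lambda>n. s (f n))"
      using f(2) by (auto simp: monoseq_iff)
    \<comment> \<open>A decreasing sequence of naturals is constant from the position of its minimum
      on, and a constant tail is increasing too.\<close>
    define n0 where "n0 = (ARG_MIN (\<lambda>n. s (f n)) n. True)"
    have "s (f n0) \<le> s (f n)" for n
      unfolding n0_def by (rule arg_min_nat_le) simp
    then have "s (f (n0 + n)) = s (f n0)" for n
      using antimonoD[OF dec, of n0 "n0 + n"] by (simp add: le_antisym)
    then have "mono (\<lambda>n. s (f (n0 + n)))" by (simp add: mono_def)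
    moreover have "strict_mono (\<lambda>n. f (n0 + n))"
      using f(1) by (auto simp: strict_mono_def)
    ultimately show ?thesis by blast
  qed (use f in blast)
qed

lemma Dickson_mono_subseq:
  fixes s :: "nat \<Rightarrow> 'a \<Rightarrow> nat"
  assumes "finite S"
  shows "\<exists>f :: nat \<Rightarrow> nat. strict_mono f \<and> (\<forall>a\<in>S. mono (\<lambda>n. s (f n) a))"
  using assms
proof (induction S rule: finite_induct)
  case empty
  then show ?case using strict_mono_id by blast
next
  case (insert x S)
  then obtain f :: "nat \<Rightarrow> nat" where f: "strict_mono f" "\<forall>a\<in>S. mono (\<lambda>n. s (f n) a)" by blast
  obtain h :: "nat \<Rightarrow> nat" where h: "strict_mono h" "mono (\<lambda>n. s (f (h n)) x)"
    using nat_seq_mono_subseq[of "\<lambda>n. s (f n) x"] by blast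
  have "mono (\<lambda>n. s (f (h n)) a)" if "a \<in> S" for a
    using f(2) that strict_mono_mono[OF h(1)] by (auto simp: mono_def)
  moreover have "strict_mono (\<lambda>n. f (h n))"
    using f(1) h(1) by (simp add: strict_mono_def)
  ultimately show ?case using h(2) by auto
qed

section \<open>The Graver basis\<close>

definition conformal :: "('b \<Rightarrow>\<^sub>0 int) \<Rightarrow> ('b \<Rightarrow>\<^sub>0 int) \<Rightarrow> bool" where
  "conformal y z \<longleftrightarrow> (\<forall>a. (0 \<le> Poly_Mapping.lookup y a \<and> Poly_Mapping.lookup y a \<le> Poly_Mapping.lookup z a) \<or>
     (Poly_Mapping.lookup z a \<le> Poly_Mapping.lookup y a \<and> Poly_Mapping.lookup y a \<le> 0))"

definition graver :: "'v graph \<Rightarrow> (('v \<Rightarrow> nat) \<Rightarrow>\<^sub>0 int) set" where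
  "graver G = {z \<in> graph_ker G. z \<noteq> 0 \<and> (\<forall>y\<in>graph_ker G. y \<noteq> 0 \<longrightarrow> conformal y z \<longrightarrow> y = z)}"

lemma conformal_trans: "conformal x y \<Longrightarrow> conformal y z \<Longrightarrow> conformal x z"
  unfolding conformal_def by (smt (verit))

lemma l1_norm_nonneg: "0 \<le> l1_norm z"
  by (simp add: l1_norm_def sum_nonneg)

lemma l1_norm_pos: "z \<noteq> 0 \<Longrightarrow> 0 < l1_norm z"
  unfolding l1_norm_def by (intro sum_pos) (auto simp: in_keys_iff)

text \<open>No coordinate cancels, so absolute values subtract. The norm thereby becomes the measure
  for the inductions in \<open>graver_conformal_exists\<close> and
  \<open>graver_path\<close>.\<close>

lemma l1_norm_conformal:
  assumes "conformal y z"
  shows "l1_norm (z - y) = l1_norm z - l1_norm y"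
proof -
  define S where "S = Poly_Mapping.keys z \<union> Poly_Mapping.keys y"
  have S: "finite S" "Poly_Mapping.keys z \<subseteq> S" "Poly_Mapping.keys y \<subseteq> S" "Poly_Mapping.keys (z - y) \<subseteq> S"
    using keys_diff[of z y] by (auto simp: S_def)
  have "\<bar>Poly_Mapping.lookup (z - y) a\<bar> = \<bar>Poly_Mapping.lookup z a\<bar> - \<bar>Poly_Mapping.lookup y a\<bar>" for a
    using assms unfolding conformal_def lookup_minus by (smt (verit))
  then show ?thesis
    by (simp add: l1_norm_superset[OF S(1)] S sum_subtractf)
qed

text \<open>Two different Graver elements are never comparable in the conformal order, while
  Dickson's lemma finds a comparable pair in every infinite sequence.\<close>

lemma finite_graver:
  assumes "finite (fst G)"
  shows "finite (graver G)"
proof (rule ccontr)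
  assume "infinite (graver G)"
  then obtain z :: "nat \<Rightarrow> _" where z: "inj z" "range z \<subseteq> graver G"
    using infinite_countable_subset by blast
  \<comment> \<open>Positive and negative parts are listed as separate natural coordinates, selected
    by the Boolean; weak growth of both parts amounts to conformality.\<close>
  define s :: "nat \<Rightarrow> _ \<Rightarrow> nat" where
    "s = (\<lambda>n (a, b). nat (if b then Poly_Mapping.lookup (z n) a else - Poly_Mapping.lookup (z n) a))"
  have "finite (labelings (fst G) \<times> (UNIV :: bool set))"
    using finite_labelings[OF assms] by simp
  then obtain f :: "nat \<Rightarrow> nat" where f: "strict_mono f" "\<forall>p\<in>labelings (fst G) \<times> UNIV. mono (\<lambda>n. s (f n) p)"
    using Dickson_mono_subseq[of _ s] by blast
  have mem: "z n \<in> graver G" for n using z by blast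
  have "conformal (z (f 0)) (z (f 1))"
    unfolding conformal_def
  proof
    fix a
    show "(0 \<le> Poly_Mapping.lookup (z (f 0)) a \<and> Poly_Mapping.lookup (z (f 0)) a \<le> Poly_Mapping.lookup (z (f 1)) a) \<or>
     (Poly_Mapping.lookup (z (f 1)) a \<le> Poly_Mapping.lookup (z (f 0)) a \<and> Poly_Mapping.lookup (z (f 0)) a \<le> 0)"
    proof (cases "a \<in> labelings (fst G)")
      case True
      then have "s (f 0) (a, b) \<le> s (f 1) (a, b)" for b
        using f(2) by (auto simp: mono_def)
      from this[of True] this[of False] show ?thesis
        by (auto simp: s_def)
    next
      case False
      have "Poly_Mapping.keys (z n) \<subseteq> labelings (fst G)" for n
        using mem[of n] by (auto simp: graver_def graph_ker_iff int_lattice_def)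
      with False have "Poly_Mapping.lookup (z n) a = 0" for n
        by (metis in_keys_iff subsetD)
      then show ?thesis by simp
    qed
  qed
  then have "z (f 0) = z (f 1)"
    using mem[of "f 0"] mem[of "f 1"] by (auto simp: graver_def)
  then show False
    using z(1) f(1) by (metis injD strict_mono_eq zero_neq_one)
qed

lemma graver_conformal_exists:
  assumes "z \<in> graph_ker G" "z \<noteq> 0"
  shows "\<exists>g\<in>graver G. conformal g z"
  using assms
proof (induction "nat (l1_norm z)" arbitrary: z rule: less_induct)
  case less
  show ?case
  proof (cases "z \<in> graver G")
    case True
    then show ?thesis by (auto simp: conformal_def)
  next
    case False
    then obtain y where y: "y \<in> graph_ker G" "y \<noteq> 0" "conformal y z" "y \<noteq> z"
      using less by (auto simp: graver_def)
    have "l1_norm y < l1_norm z"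
      using l1_norm_conformal[OF y(3)] l1_norm_pos[of "z - y"] y(4) by simp
    then obtain g where "g \<in> graver G" "conformal g y"
      using less(1)[of y] y l1_norm_nonneg[of y] by auto
    then show ?thesis using conformal_trans y(3) by blast
  qed
qed

text \<open>A step conformal to \<open>v2 - v1\<close> keeps every coordinate between those of
  \<open>v1\<close> and \<open>v2\<close>, hence non-negative, and strictly shortens the remaining
  distance.\<close>

lemma graver_path:
  assumes "v1 \<in> int_lattice (fst G)" "v2 \<in> int_lattice (fst G)" "nonneg v1" "nonneg v2"
    "v2 - v1 \<in> graph_ker G"
  shows "\<exists>us. set us \<subseteq> graver G \<and> v1 + sum_list us = v2 \<and>
    (\<forall>l\<in>{1..length us}. nonneg (v1 + sum_list (take l us)))"
  using assms
proof (induction "nat (l1_norm (v2 - v1))" arbitrary: v1 rule: less_induct)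
  case less
  show ?case
  proof (cases "v1 = v2")
    case True
    then show ?thesis by (intro exI[of _ "[]"]) auto
  next
    case False
    then obtain g where g: "g \<in> graver G" "conformal g (v2 - v1)"
      using graver_conformal_exists less.prems(5) by (metis eq_iff_diff_eq_0)
    have gk: "g \<in> graph_ker G" "g \<noteq> 0" using g by (auto simp: graver_def)
    have nn: "nonneg (v1 + g)"
      using g(2) less.prems(3,4) unfolding nonneg_def conformal_def lookup_minus lookup_add
      by (smt (verit))
    have lat: "v1 + g \<in> int_lattice (fst G)"
      using less.prems gk by (auto simp: graph_ker_iff int_lattice_add)
    have eq: "v2 - (v1 + g) = (v2 - v1) - g" by simp
    have ker: "v2 - (v1 + g) \<in> graph_ker G"
      unfolding eq by (rule graph_ker_diff[OF less.prems(5) gk(1)])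
    have "l1_norm (v2 - (v1 + g)) < l1_norm (v2 - v1)"
      unfolding eq l1_norm_conformal[OF g(2)] using l1_norm_pos[OF gk(2)] by simp
    then have "nat (l1_norm (v2 - (v1 + g))) < nat (l1_norm (v2 - v1))"
      using l1_norm_nonneg[of "v2 - (v1 + g)"] by simp
    then obtain us where us: "set us \<subseteq> graver G" "v1 + g + sum_list us = v2"
      "\<forall>l\<in>{1..length us}. nonneg (v1 + g + sum_list (take l us))"
      using less.hyps[of "v1 + g"] lat less.prems nn ker by blast
    have "nonneg (v1 + sum_list (take l (g # us)))" if "l \<in> {1..length (g # us)}" for l
    proof (cases "l = 1")
      case True
      then show ?thesis using nn by simp
    next
      case False
      with that have "l - 1 \<in> {1..length us}" by auto
      then have "nonneg (v1 + g + sum_list (take (l - 1) us))" using us(3) by blast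
      then show ?thesis using that by (cases l) (auto simp: add.assoc)
    qed
    then show ?thesis using us g(1)
      by (intro exI[of _ "g # us"]) (auto simp: add.assoc)
  qed
qed

lemma markov_basis_graver: "finite (fst G) \<Longrightarrow> markov_basis G (graver G)"
  unfolding markov_basis_def
proof (intro conjI ballI impI)
  show "graver G \<subseteq> graph_ker G" by (auto simp: graver_def)
  fix v1 v2
  assume "v1 \<in> int_lattice (fst G)" "v2 \<in> int_lattice (fst G)" "nonneg v1" "nonneg v2"
    "graph_proj G v1 = graph_proj G v2"
  then show "\<exists>us. set us \<subseteq> graver G \<union> uminus ` graver G \<and> v1 + sum_list us = v2 \<and>
    (\<forall>l\<in>{1..length us}. nonneg (v1 + sum_list (take l us)))"
    using graver_path[of v1 G v2] diff_in_graph_ker[of v1 G v2] by blast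
qed (rule finite_graver)

section \<open>Attainment of the Markov width and a lower bound criterion\<close>

lemma markov_width_attained:
  assumes "finite (fst G)"
  obtains B where "markov_basis G B" "\<forall>v\<in>B. l1_norm v \<le> 2 * int (markov_width G)"
proof -
  \<comment> \<open>A crude common bound; what matters is that the set under \<open>LEAST\<close> is
    inhabited.\<close>
  define k where "k = nat (\<Sum>v\<in>graver G. l1_norm v)"
  have fin: "finite (graver G)" using finite_graver[OF assms] .
  have "l1_norm v \<le> 2 * int k" if "v \<in> graver G" for v
  proof -
    have "l1_norm v \<le> (\<Sum>v\<in>graver G. l1_norm v)"
      using that fin by (intro member_le_sum) (auto simp: l1_norm_nonneg)
    then show ?thesis using l1_norm_nonneg[of v] by (simp add: k_def)
  qed
  then have "\<exists>k B. markov_basis G B \<and> (\<forall>v\<in>B. l1_norm v \<le> 2 * int k)"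
    using markov_basis_graver[OF assms] by blast
  from LeastI_ex[OF this] show thesis
    using that unfolding markov_width_def by blast
qed

text \<open>A path from \<open>v1\<close> to \<open>v2\<close> has to leave \<open>v1\<close> by a
  single basis move, and this move is a nonzero kernel element applicable at
  \<open>v1\<close>.\<close>

lemma markov_width_ge:
  assumes fin: "finite (fst G)"
    and v: "v1 \<in> int_lattice (fst G)" "v2 \<in> int_lattice (fst G)" "nonneg v1" "nonneg v2"
      "graph_proj G v1 = graph_proj G v2" "v1 \<noteq> v2"
    and large: "\<And>u. u \<in> graph_ker G \<Longrightarrow> u \<noteq> 0 \<Longrightarrow> nonneg (v1 + u) \<Longrightarrow> 2 * K \<le> l1_norm u"
  shows "K \<le> int (markov_width G)"
proof -
  obtain B where B: "markov_basis G B" "\<forall>v\<in>B. l1_norm v \<le> 2 * int (markov_width G)"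
    using markov_width_attained[OF fin] by blast
  then obtain us where us: "set us \<subseteq> B \<union> uminus ` B" "v1 + sum_list us = v2"
    "\<forall>l\<in>{1..length us}. nonneg (v1 + sum_list (take l us))"
    using v unfolding markov_basis_def by blast
  have "sum_list (take (length us) us) \<noteq> 0" using us(2) v(6) by auto
  \<comment> \<open>A basis may contain 0, so the path may pause at \<open>v1\<close>;
    \<open>l\<close> marks the first partial sum that is not 0.\<close>
  define l where "l = (LEAST l. sum_list (take l us) \<noteq> 0)"
  have l: "sum_list (take l us) \<noteq> 0" "l \<le> length us"
    unfolding l_def by (rule LeastI, fact) (rule Least_le, fact)
  have "l \<noteq> 0" using l by (intro notI) simp
  then obtain m where m: "l = Suc m" by (cases l) auto
  have "sum_list (take m us) = 0"
    using not_less_Least[of m "\<lambda>l. sum_list (take l us) \<noteq> 0"] m by (simp add: l_def)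
  then have sl: "sum_list (take l us) = us ! m"
    using m l(2) by (simp add: take_Suc_conv_app_nth)
  let ?u = "us ! m"
  have "?u \<in> B \<union> uminus ` B" using us(1) m l(2) by (simp add: subset_iff)
  moreover have "B \<subseteq> graph_ker G" using B(1) by (simp add: markov_basis_def)
  ultimately have "?u \<in> graph_ker G" and "l1_norm ?u \<le> 2 * int (markov_width G)"
    using B(2) by (auto simp: l1_norm_uminus intro!: graph_ker_uminus)
  moreover have "nonneg (v1 + ?u)" "?u \<noteq> 0"
    using bspec[OF us(3), of l] l sl m by auto
  then have "2 * K \<le> l1_norm ?u"
    using large calculation by blast
  ultimately show ?thesis by linarith
qed

section \<open>Supports of vectors in a fibre\<close>

lemma sum_frag_of_int_lattice:
  assumes "\<And>p. p \<in> I \<Longrightarrow> f p \<in> labelings X"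
  shows "(\<Sum>p\<in>I. frag_of (f p)) \<in> int_lattice X"
  unfolding int_lattice_def using assms
  by (auto dest!: subsetD[OF keys_sum])

text \<open>The total coefficient on the labelings that agree with \<open>a\<close> at
  \<open>i\<close> and \<open>j\<close> is not changed by \<open>u\<close>. If no key of
  \<open>v\<close> agrees, it is 0, and then non-negativity makes every term vanish.\<close>

lemma fibre_pair_support:
  assumes u: "u \<in> graph_ker G" and fin: "finite (fst G)" and e: "{i, j} \<in> snd G"
    and v: "v \<in> int_lattice (fst G)" "nonneg (v + u)"
    and a: "a \<in> labelings (fst G)" "Poly_Mapping.lookup (v + u) a \<noteq> 0"
  shows "\<exists>t\<in>Poly_Mapping.keys v. t i = a i \<and> t j = a j"
proof (rule ccontr)
  assume neg: "\<not> ?thesis"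
  let ?S = "labelings (fst G)"
  let ?\<phi> = "\<lambda>b. of_bool (b i = a i \<and> b j = a j) :: int"
  note fS = finite_labelings[OF fin]
  have "(\<Sum>b\<in>?S. Poly_Mapping.lookup u b * ?\<phi> b) = 0"
    using graph_ker_pair_sum[OF u fin e, of "\<lambda>p q. of_bool (p = a i \<and> q = a j)"] by simp
  moreover have "(\<Sum>b\<in>?S. Poly_Mapping.lookup v b * ?\<phi> b) = 0"
    using neg by (intro sum.neutral) (auto simp: in_keys_iff)
  ultimately have "(\<Sum>b\<in>?S. Poly_Mapping.lookup (v + u) b * ?\<phi> b) = 0"
    by (simp add: lookup_add distrib_right sum.distrib)
  moreover have "0 \<le> Poly_Mapping.lookup (v + u) b * ?\<phi> b" for b
    using v(2) by (simp add: nonneg_def)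
  ultimately have "Poly_Mapping.lookup (v + u) a * ?\<phi> a = 0"
    using sum_nonneg_eq_0_iff[OF fS, of "\<lambda>b. Poly_Mapping.lookup (v + u) b * ?\<phi> b"] a(1) by auto
  then show False using a(2) by simp
qed

lemma fst_complete_graph: "fst (complete_graph n) = {..<n}"
  by (simp add: complete_graph_def)

text \<open>The functional \<open>1 - (\<Sum>i\<in>P. int (b i))\<close> is a sum of functions of
  single coordinates, so \<open>u\<close> does not change its total, which is 0 on \<open>v\<close>.
  By \<open>le\<close> all terms are non-negative, so each of them vanishes.\<close>

lemma fibre_part_sum:
  fixes a :: "nat \<Rightarrow> nat"
  assumes u: "u \<in> graph_ker (complete_graph n)" and n: "2 \<le> n" and P: "P \<subseteq> {..<n}"
    and v: "v \<in> int_lattice {..<n}" "nonneg (v + u)"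
    and v1: "\<And>t. t \<in> Poly_Mapping.keys v \<Longrightarrow> (\<Sum>i\<in>P. t i) = 1"
    and le: "\<And>b. b \<in> labelings {..<n} \<Longrightarrow> Poly_Mapping.lookup (v + u) b \<noteq> 0 \<Longrightarrow> (\<Sum>i\<in>P. b i) \<le> 1"
    and a: "a \<in> labelings {..<n}" "Poly_Mapping.lookup (v + u) a \<noteq> 0"
  shows "(\<Sum>i\<in>P. a i) = 1"
proof -
  let ?S = "labelings {..<n}"
  let ?\<phi> = "\<lambda>b. 1 - (\<Sum>i\<in>P. int (b i))"
  have fS: "finite ?S" by (rule finite_labelings) simp
  have edge: "{i, j} \<in> snd (complete_graph n)" if "i < n" "j < n" "i \<noteq> j" for i j
    using that by (auto simp: complete_graph_def)
  have u0: "(\<Sum>b\<in>?S. Poly_Mapping.lookup u b) = 0"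
    using graph_ker_pair_sum[OF u, of 0 1 "\<lambda>_ _. 1"] edge[of 0 1] n by (simp add: fst_complete_graph)
  \<comment> \<open>A single-coordinate moment is read off any edge at \<open>i\<close>; the other
    end is 0, or 1 if \<open>i\<close> itself is 0.\<close>
  have u1: "(\<Sum>b\<in>?S. Poly_Mapping.lookup u b * int (b i)) = 0" if "i < n" for i
    using graph_ker_pair_sum[OF u, of i "if i = 0 then 1 else 0" "\<lambda>p _. int p"]
      edge[of i "if i = 0 then 1 else 0"] n that by (simp add: fst_complete_graph)
  have "(\<Sum>b\<in>?S. Poly_Mapping.lookup u b * ?\<phi> b) =
      (\<Sum>b\<in>?S. Poly_Mapping.lookup u b) - (\<Sum>b\<in>?S. \<Sum>i\<in>P. Poly_Mapping.lookup u b * int (b i))"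
    by (simp add: right_diff_distrib sum_subtractf sum_distrib_left)
  also have "(\<Sum>b\<in>?S. \<Sum>i\<in>P. Poly_Mapping.lookup u b * int (b i)) = 0"
    by (subst sum.swap, rule sum.neutral) (use u1 P in blast)
  finally have "(\<Sum>b\<in>?S. Poly_Mapping.lookup u b * ?\<phi> b) = 0" using u0 by simp
  moreover have "(\<Sum>b\<in>?S. Poly_Mapping.lookup v b * ?\<phi> b) = 0"
  proof (intro sum.neutral ballI)
    fix b
    show "Poly_Mapping.lookup v b * ?\<phi> b = 0"
      using v1[of b] by (cases "b \<in> Poly_Mapping.keys v") (auto simp: in_keys_iff simp flip: of_nat_sum)
  qed
  ultimately have "(\<Sum>b\<in>?S. Poly_Mapping.lookup (v + u) b * ?\<phi> b) = 0"
    by (simp only: lookup_add distrib_right sum.distrib)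
  moreover have "0 \<le> Poly_Mapping.lookup (v + u) b * ?\<phi> b" if "b \<in> ?S" for b
    using le[OF that] v(2)
    by (cases "Poly_Mapping.lookup (v + u) b = 0") (auto simp: nonneg_def simp flip: of_nat_sum)
  ultimately have "Poly_Mapping.lookup (v + u) a * ?\<phi> a = 0"
    using sum_nonneg_eq_0_iff[OF fS, of "\<lambda>b. Poly_Mapping.lookup (v + u) b * ?\<phi> b"] a(1) by auto
  then show ?thesis using a(2) by (simp flip: of_nat_sum)
qed

section \<open>Periodic sums and functions\<close>

lemma sum_shift_periodic_nat:
  fixes H :: "nat \<Rightarrow> 'b :: ab_group_add"
  assumes "H M = H 0"
  shows "(\<Sum>k<M. H (Suc k)) = (\<Sum>k<M. H k)"
  using sum.lessThan_Suc_shift[of H M] assms by simp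

lemma sum_shift_periodic_int:
  fixes H :: "int \<Rightarrow> 'b :: comm_monoid_add"
  assumes "\<And>x. H (x mod int N) = H x" "N > 0"
  shows "(\<Sum>x\<in>{0..<int N}. H (x + c)) = (\<Sum>x\<in>{0..<int N}. H x)"
  by (rule sum.reindex_bij_witness[of _ "\<lambda>x. (x - c) mod int N" "\<lambda>x. (x + c) mod int N"])
     (use assms in \<open>auto simp: mod_simps\<close>)

lemma sum_of_bool_two:
  fixes h :: "'a \<Rightarrow> int"
  assumes "finite S" "p \<in> S" "q \<in> S" "p \<noteq> q" "\<phi> p" "\<phi> q"
    and "\<And>a. a \<in> S \<Longrightarrow> h a \<noteq> 0 \<Longrightarrow> \<phi> a \<Longrightarrow> a = p \<or> a = q"
  shows "(\<Sum>a\<in>S. h a * of_bool (\<phi> a)) = h p + h q"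
proof -
  have "(\<Sum>a\<in>S. h a * of_bool (\<phi> a)) = (\<Sum>a\<in>{p, q}. h a * of_bool (\<phi> a))"
    using assms by (intro sum.mono_neutral_right) auto
  then show ?thesis using assms by simp
qed

text \<open>The periods of \<open>c\<close> form a subgroup of the integers, and by Bezout it
  contains 1.\<close>

lemma periodic_constant_int:
  fixes c :: "int \<Rightarrow> 'b"
  assumes "coprime r s" and r: "\<And>y. c (y + r) = c y" and s: "\<And>y. c (y + s) = c y"
  shows "c y = c 0"
proof -
  have mult: "c (y + t * j) = c y" if t: "\<And>y. c (y + t) = c y" for t y j
  proof (induction j rule: int_induct[where k = 0])
    case (step1 i)
    then show ?case using t[of "y + t * i"] by (simp add: algebra_simps)
  next
    case (step2 i)
    then show ?case using t[of "y + t * (i - 1)"] by (simp add: algebra_simps)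
  qed simp
  obtain a b where "a * r + b * s = 1"
    using bezout_int[of r s] assms(1) by auto
  then have "y = 0 + r * (a * y) + s * (b * y)"
    by (metis add.left_neutral distrib_right mult.assoc mult.commute mult_1)
  then show ?thesis using mult[OF r] mult[OF s] by metis
qed

lemma sum_le_1_if_unique:
  fixes a :: "nat \<Rightarrow> nat"
  assumes P: "finite P" "\<And>i. i \<in> P \<Longrightarrow> a i = 0 \<or> a i = 1"
    and un: "\<And>i j. i \<in> P \<Longrightarrow> j \<in> P \<Longrightarrow> a i = 1 \<Longrightarrow> a j = 1 \<Longrightarrow> i = j"
  shows "sum a P \<le> 1"
proof (cases "\<exists>i\<in>P. a i = 1")
  case True
  then obtain i where i: "i \<in> P" "a i = 1" by blast
  then have "\<forall>j\<in>P - {i}. a j = 0" using P(2) un by blast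
  then have "sum a P = sum a {i}"
    using P(1) i by (intro sum.mono_neutral_right) auto
  then show ?thesis using i by simp
next
  case False
  then have "sum a P = 0" using P(2) by (intro sum.neutral) blast
  then show ?thesis by simp
qed

lemma Suc_mod_eq_iff: "Suc i mod M = Suc j mod M \<longleftrightarrow> i mod M = j mod M"
  using nat_mod_eq_iff[of i M j] nat_mod_eq_iff[of "Suc i" M "Suc j"] by simp

section \<open>The fibre of a triangle system\<close>

text \<open>The bound \<open>g_less\<close> keeps sums of two values below \<open>N\<close>, so that
  congruences between such sums are equalities. \<open>sidon\<close> controls which triples of edges
  close up to a triangle; \<open>odd_N\<close> and \<open>step_diff\<close> make all triangles
  connected through common edges.\<close>

locale triangle_cycle =
  fixes g :: "nat \<Rightarrow> int" and M N n :: nat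
  assumes M3: "3 \<le> M"
    and g_eq_iff: "g i = g j \<longleftrightarrow> i mod M = j mod M"
    and g_nonneg: "0 \<le> g k" and g_less: "2 * g k < int N"
    and sidon: "g i + g j = g k + g (Suc k) \<Longrightarrow>
      (g i = g k \<and> g j = g (Suc k)) \<or> (g i = g (Suc k) \<and> g j = g k)"
    and odd_N: "odd N" and step_diff: "g 3 - g 1 = g 2 - g 0 + 4"
    and n: "3 * N \<le> n"
begin

lemma N_pos: "0 < N" using odd_N by (cases N) auto

lemma n_ge_2: "2 \<le> n" using n N_pos by simp

lemma g_Suc_eq_iff: "g (Suc i) = g (Suc j) \<longleftrightarrow> g i = g j"
  unfolding g_eq_iff by (rule Suc_mod_eq_iff)

lemma g_Suc_Suc_neq: "g (Suc (Suc i)) \<noteq> g i"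
proof -
  have "Suc (Suc i) mod M \<noteq> i mod M"
  proof
    assume "Suc (Suc i) mod M = i mod M"
    then have "M dvd Suc (Suc i) - i"
      by (metis mod_eq_dvd_iff_nat le_SucI le_refl)
    then show False using M3 by (auto dest: dvd_imp_le)
  qed
  then show ?thesis by (simp add: g_eq_iff)
qed

lemma dvd_N_imp_eq:
  assumes "\<bar>a - b\<bar> < int N" "int N dvd a - b"
  shows "a = b"
  using assms zdvd_not_zless[of "\<bar>a - b\<bar>" "int N"] by auto

lemma g_mod_cancel:
  assumes "int N dvd g i - g j"
  shows "g i = g j"
proof (rule dvd_N_imp_eq[OF _ assms])
  show "\<bar>g i - g j\<bar> < int N"
    using g_nonneg[of i] g_nonneg[of j] g_less[of i] g_less[of j] by linarith
qed

lemma g_add_mod_cancel: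
  assumes "int N dvd (g i + g j) - (g k + g l)"
  shows "g i + g j = g k + g l"
proof (rule dvd_N_imp_eq[OF _ assms])
  show "\<bar>(g i + g j) - (g k + g l)\<bar> < int N"
    using g_nonneg[of i] g_nonneg[of j] g_less[of i] g_less[of j]
      g_nonneg[of k] g_nonneg[of l] g_less[of k] g_less[of l] by linarith
qed

text \<open>A swap would give \<open>g (Suc (Suc m)) = g m\<close>, impossible in a cycle of length
  at least 3. This keeps triangles of opposite sign apart.\<close>

lemma consecutive_not_swapped:
  assumes "g k = g (Suc m)" "g (Suc k) = g m"
  shows False
proof -
  have "g (Suc (Suc m)) = g (Suc k)" using assms(1) by (simp add: g_Suc_eq_iff)
  then show False using g_Suc_Suc_neq[of m] assms(2) by simp
qed

lemma consecutive_sum_inj: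
  assumes "g m + g (Suc m) = g k + g (Suc k)"
  shows "g m = g k"
  using sidon[OF assms] consecutive_not_swapped[of m k] by blast

text \<open>The vertices are three copies \<open>x\<close>, \<open>N + y\<close>, \<open>2 * N + z\<close> of the residues modulo \<open>N\<close>;
  the vertices from \<open>3 * N\<close> on are unused.\<close>

definition triangle :: "int \<Rightarrow> int \<Rightarrow> int \<Rightarrow> nat \<Rightarrow> nat" where
  "triangle x y z = (\<lambda>i\<in>{..<n}. if i = nat (x mod int N) \<or> i = N + nat (y mod int N) \<or>
     i = 2 * N + nat (z mod int N) then 1 else 0)"

text \<open>The differences \<open>x - y\<close> and \<open>z - x\<close> are consecutive terms of
  the cycle, in this order for positive and swapped for negative triangles; \<open>z - y\<close> is
  the same consecutive sum for both signs.\<close>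

definition tpos :: "int \<Rightarrow> nat \<Rightarrow> nat \<Rightarrow> nat" where
  "tpos x k = triangle x (x - g k) (x + g (Suc k))"

definition tneg :: "int \<Rightarrow> nat \<Rightarrow> nat \<Rightarrow> nat" where
  "tneg x k = triangle x (x - g (Suc k)) (x + g k)"

section \<open>Coordinates and equality of triangles\<close>

lemma nat_mod_N_less: "nat (x mod int N) < N"
  using N_pos by (simp add: nat_less_iff)

lemma nat_mod_N_eq_iff: "nat (x mod int N) = nat (y mod int N) \<longleftrightarrow> int N dvd x - y"
  using N_pos by (simp add: nat_eq_iff mod_eq_dvd_iff)

lemma triangle_in_labelings: "triangle x y z \<in> labelings {..<n}"
  by (auto simp: triangle_def labelings_def)

lemma triangle_X: "i < N \<Longrightarrow> triangle x y z i = of_bool (i = nat (x mod int N))"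
  using nat_mod_N_less[of x] nat_mod_N_less[of y] nat_mod_N_less[of z] n by (auto simp: triangle_def)

lemma triangle_Y: "i < N \<Longrightarrow> triangle x y z (N + i) = of_bool (i = nat (y mod int N))"
  using nat_mod_N_less[of x] nat_mod_N_less[of y] nat_mod_N_less[of z] n by (auto simp: triangle_def)

lemma triangle_Z: "i < N \<Longrightarrow> triangle x y z (2 * N + i) = of_bool (i = nat (z mod int N))"
  using nat_mod_N_less[of x] nat_mod_N_less[of y] nat_mod_N_less[of z] n by (auto simp: triangle_def)

lemma triangle_rest: "3 * N \<le> i \<Longrightarrow> i < n \<Longrightarrow> triangle x y z i = 0"
  using nat_mod_N_less[of x] nat_mod_N_less[of y] nat_mod_N_less[of z] n by (auto simp: triangle_def)

lemma triangle_cong: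
  assumes "int N dvd x - x'" "int N dvd y - y'" "int N dvd z - z'"
  shows "triangle x y z = triangle x' y' z'"
  using assms unfolding triangle_def nat_mod_N_eq_iff[symmetric] by simp

lemma triangle_at_X: "triangle x y z (nat (r mod int N)) = 1 \<longleftrightarrow> int N dvd x - r"
  by (auto simp: triangle_X nat_mod_N_less nat_mod_N_eq_iff dvd_diff_commute)

lemma triangle_at_Y: "triangle x y z (N + nat (r mod int N)) = 1 \<longleftrightarrow> int N dvd y - r"
  by (auto simp: triangle_Y nat_mod_N_less nat_mod_N_eq_iff dvd_diff_commute)

lemma triangle_at_Z: "triangle x y z (2 * N + nat (r mod int N)) = 1 \<longleftrightarrow> int N dvd z - r"
  by (auto simp: triangle_Z nat_mod_N_less nat_mod_N_eq_iff dvd_diff_commute)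

lemma triangle_eq_iff:
  "triangle x y z = triangle x' y' z' \<longleftrightarrow> int N dvd x - x' \<and> int N dvd y - y' \<and> int N dvd z - z'"
proof
  assume eq: "triangle x y z = triangle x' y' z'"
  show "int N dvd x - x' \<and> int N dvd y - y' \<and> int N dvd z - z'"
    using triangle_at_X[of x y z x'] triangle_at_Y[of x y z y'] triangle_at_Z[of x y z z']
      triangle_at_X[of x' y' z' x'] triangle_at_Y[of x' y' z' y'] triangle_at_Z[of x' y' z' z'] by (simp add: eq)
qed (simp add: triangle_cong)

lemma tpos_cong:
  assumes "int N dvd x - x'" "g k = g k'"
  shows "tpos x k = tpos x' k'"
  using assms g_Suc_eq_iff[of k k'] by (auto simp: tpos_def triangle_eq_iff)

lemma tneg_cong:
  assumes "int N dvd x - x'" "g k = g k'"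
  shows "tneg x k = tneg x' k'"
  using assms g_Suc_eq_iff[of k k'] by (auto simp: tneg_def triangle_eq_iff)

lemma tpos_eq_iff: "tpos x k = tpos x' k' \<longleftrightarrow> int N dvd x - x' \<and> g k = g k'"
proof
  assume "tpos x k = tpos x' k'"
  then have *: "int N dvd x - x'" "int N dvd (x - g k) - (x' - g k')"
    by (auto simp: tpos_def triangle_eq_iff)
  then show "int N dvd x - x' \<and> g k = g k'"
    using dvd_diff[OF *] g_mod_cancel[of k k'] by (simp add: algebra_simps)
qed (auto intro: tpos_cong)

lemma tneg_eq_iff: "tneg x k = tneg x' k' \<longleftrightarrow> int N dvd x - x' \<and> g k = g k'"
proof
  assume "tneg x k = tneg x' k'"
  then have *: "int N dvd x - x'" "int N dvd (x + g k) - (x' + g k')"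
    by (auto simp: tneg_def triangle_eq_iff)
  then show "int N dvd x - x' \<and> g k = g k'"
    using dvd_diff[OF *(2,1)] g_mod_cancel[of k k'] by (simp add: algebra_simps)
qed (auto intro: tneg_cong)

lemma tpos_neq_tneg: "tpos x k \<noteq> tneg x' k'"
proof
  assume "tpos x k = tneg x' k'"
  then have *: "int N dvd x - x'" "int N dvd (x - g k) - (x' - g (Suc k'))"
    "int N dvd (x + g (Suc k)) - (x' + g k')"
    by (auto simp: tpos_def tneg_def triangle_eq_iff)
  have "g k = g (Suc k')"
    using dvd_diff[OF *(1,2)] g_mod_cancel[of k "Suc k'"] by (simp add: algebra_simps)
  moreover have "g (Suc k) = g k'"
    using dvd_diff[OF *(3,1)] g_mod_cancel[of "Suc k" k'] by (simp add: algebra_simps)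
  ultimately show False
    by (rule consecutive_not_swapped)
qed

section \<open>Two vectors in one fibre\<close>

definition idx :: "(int \<times> nat) set" where
  "idx = {0..<int N} \<times> {..<M}"

definition vpos :: "(nat \<Rightarrow> nat) \<Rightarrow>\<^sub>0 int" where
  "vpos = (\<Sum>p\<in>idx. frag_of (tpos (fst p) (snd p)))"

definition vneg :: "(nat \<Rightarrow> nat) \<Rightarrow>\<^sub>0 int" where
  "vneg = (\<Sum>p\<in>idx. frag_of (tneg (fst p) (snd p)))"

lemma finite_idx: "finite idx" by (simp add: idx_def)

lemma vpos_lattice: "vpos \<in> int_lattice {..<n}" and vneg_lattice: "vneg \<in> int_lattice {..<n}"
  unfolding vpos_def vneg_def tpos_def tneg_def by (intro sum_frag_of_int_lattice triangle_in_labelings)+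

lemma vpos_nonneg: "nonneg vpos" and vneg_nonneg: "nonneg vneg"
  unfolding vpos_def vneg_def nonneg_def by (auto simp: lookup_sum intro!: sum_nonneg)

lemma keys_vpos: "t \<in> Poly_Mapping.keys vpos \<Longrightarrow> \<exists>x k. t = tpos x k"
  unfolding vpos_def by (auto dest!: subsetD[OF keys_sum]) blast

lemma keys_vneg: "t \<in> Poly_Mapping.keys vneg \<Longrightarrow> \<exists>x k. t = tneg x k"
  unfolding vneg_def by (auto dest!: subsetD[OF keys_sum]) blast

lemma vpos_neq_vneg: "vpos \<noteq> vneg"
proof
  assume eq: "vpos = vneg"
  have "Poly_Mapping.lookup vpos (tpos 0 0) > 0"
    unfolding vpos_def lookup_sum using finite_idx M3 N_pos
    by (intro sum_pos2[of _ "(0, 0)"]) (auto simp: idx_def)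
  then have "tpos 0 0 \<in> Poly_Mapping.keys vneg" by (simp add: eq in_keys_iff)
  then show False using keys_vneg tpos_neq_tneg by metis
qed

lemma restrict_triangle_eq:
  assumes "e \<subseteq> {..<n}"
    and "int N dvd x - x' \<or> e \<inter> {..<N} = {}"
    and "int N dvd y - y' \<or> e \<inter> {N..<2 * N} = {}"
    and "int N dvd z - z' \<or> e \<inter> {2 * N..<3 * N} = {}"
  shows "restrict (triangle x y z) e = restrict (triangle x' y' z') e"
proof (rule restrict_ext)
  fix i assume i: "i \<in> e"
  consider "i < N" | j where "j < N" "i = N + j" | j where "j < N" "i = 2 * N + j" | "3 * N \<le> i"
  proof -
    consider "i < N" | "N \<le> i" "i < 2 * N" | "2 * N \<le> i" "i < 3 * N" | "3 * N \<le> i" by linarith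
    then show thesis
    proof cases
      case 2
      then show ?thesis using that(2)[of "i - N"] by simp
    next
      case 3
      then show ?thesis using that(3)[of "i - 2 * N"] by simp
    qed (use that in blast)+
  qed
  then show "triangle x y z i = triangle x' y' z' i"
  proof cases
    case 1
    then show ?thesis using assms(2) i nat_mod_N_eq_iff[of x x'] by (auto simp: triangle_X)
  next
    case (2 j)
    then show ?thesis using assms(3) i nat_mod_N_eq_iff[of y y'] by (auto simp: triangle_Y)
  next
    case (3 j)
    then show ?thesis using assms(4) i nat_mod_N_eq_iff[of z z'] by (auto simp: triangle_Z)
  next
    case 4
    then show ?thesis using assms(1) i by (auto simp: triangle_rest)
  qed
qed

text \<open>A pair of vertices misses one of the three parts, and off that part the positive triangles
  are a rearrangement of the negative ones.\<close>

lemma graph_proj_eq: "graph_proj (complete_graph n) vpos = graph_proj (complete_graph n) vneg"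
  unfolding graph_proj_eq_iff
proof
  fix e assume "e \<in> snd (complete_graph n)"
  then obtain i j where e: "e = {i, j}" "i < n" "j < n"
    by (auto simp: complete_graph_def)
  then have en: "e \<subseteq> {..<n}" by auto
  let ?P = "\<lambda>x k. frag_of (restrict (tpos x k) e)"
  let ?Q = "\<lambda>x k. frag_of (restrict (tneg x k) e)"
  have pos: "proj e vpos = (\<Sum>x\<in>{0..<int N}. \<Sum>k<M. ?P x k)"
    unfolding vpos_def proj_def frag_extend_sum[OF finite_idx]
    by (simp add: idx_def sum.cartesian_product o_def split_def)
  have neg: "proj e vneg = (\<Sum>x\<in>{0..<int N}. \<Sum>k<M. ?Q x k)"
    unfolding vneg_def proj_def frag_extend_sum[OF finite_idx]
    by (simp add: idx_def sum.cartesian_product o_def split_def)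
  consider "e \<inter> {2 * N..<3 * N} = {}" | "e \<inter> {N..<2 * N} = {}" | "e \<inter> {..<N} = {}"
    unfolding e(1) by (cases "i < N"; cases "i < 2 * N"; cases "j < N"; cases "j < 2 * N") auto
  then show "proj e vpos = proj e vneg"
  proof cases
    case 1
    \<comment> \<open>Off the third part \<open>tneg x k\<close> and \<open>tpos x (Suc k)\<close>
      coincide, so \<open>k\<close> is shifted by one around the cycle. Case 2 is the same with the
      signs exchanged.\<close>
    have "?Q x k = ?P x (Suc k)" for x k
      unfolding tpos_def tneg_def using 1 en by (subst restrict_triangle_eq) auto
    moreover have "?P x M = ?P x 0" for x
      by (subst tpos_cong[of x x M 0]) (auto simp: g_eq_iff)
    ultimately show ?thesis
      unfolding pos neg by (simp add: sum_shift_periodic_nat[where H = "?P x" for x])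
  next
    case 2
    have "?P x k = ?Q x (Suc k)" for x k
      unfolding tpos_def tneg_def using 2 en by (subst restrict_triangle_eq) auto
    moreover have "?Q x M = ?Q x 0" for x
      by (subst tneg_cong[of x x M 0]) (auto simp: g_eq_iff)
    ultimately show ?thesis
      unfolding pos neg by (simp add: sum_shift_periodic_nat[where H = "?Q x" for x])
  next
    case 3
    \<comment> \<open>Off the first part, the triangles of opposite sign with the same
      \<open>k\<close> coincide after a translation of \<open>x\<close>.\<close>
    have "?P x k = ?Q (x + (g (Suc k) - g k)) k" for x k
      unfolding tpos_def tneg_def using 3 en by (subst restrict_triangle_eq) auto
    moreover have "?Q (x mod int N) k = ?Q x k" for x k
      by (subst tneg_cong[of "x mod int N" x k k]) (auto simp: mod_eq_dvd_iff[symmetric])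
    ultimately have "(\<Sum>x\<in>{0..<int N}. ?P x k) = (\<Sum>x\<in>{0..<int N}. ?Q x k)" for k
      using sum_shift_periodic_int[where H = "\<lambda>x. ?Q x k", OF _ N_pos] by simp
    then show ?thesis
      unfolding pos neg by (subst (1 2) sum.swap) simp
  qed
qed

text \<open>The first two differences add up to the third, as integers by the size bound;
  \<open>sidon\<close> leaves the two orders of \<open>m\<close> and \<open>Suc m\<close>, one for
  each sign.\<close>

lemma triangle_classify:
  assumes y: "int N dvd (x - y) - g k" and z: "int N dvd (z - x) - g l"
    and yz: "int N dvd (z - y) - (g m + g (Suc m))"
  shows "\<exists>k. triangle x y z = tpos x k \<or> triangle x y z = tneg x k"
proof -
  have y': "int N dvd y - (x - g k)" using y by (subst dvd_diff_commute) (simp add: algebra_simps)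
  have z': "int N dvd z - (x + g l)" using z by (simp add: algebra_simps)
  have "int N dvd ((z - y) - (g m + g (Suc m))) - (((x - y) - g k) + ((z - x) - g l))"
    by (rule dvd_diff[OF yz dvd_add[OF y z]])
  then have "int N dvd (g k + g l) - (g m + g (Suc m))"
    by (simp add: algebra_simps)
  then have "g k + g l = g m + g (Suc m)" by (rule g_add_mod_cancel)
  then consider "g k = g m" "g l = g (Suc m)" | "g k = g (Suc m)" "g l = g m"
    using sidon by blast
  then show ?thesis
  proof cases
    case 1
    then have "triangle x y z = tpos x m"
      using y' z' unfolding tpos_def by (intro triangle_cong) simp_all
    then show ?thesis by blast
  next
    case 2
    then have "triangle x y z = tneg x m"
      using y' z' unfolding tneg_def by (intro triangle_cong) simp_all
    then show ?thesis by blast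
  qed
qed

lemma part_bound:
  assumes "c < 3" "i \<in> {c * N..<c * N + N}"
  shows "i < n"
proof -
  have "c * N + N \<le> 3 * N" using assms(1) mult_le_mono1[of "Suc c" 3 N] by simp
  moreover have "i < c * N + N" using assms(2) by simp
  ultimately show ?thesis using n by linarith
qed

lemma triangle_part_unique:
  assumes "c < 3" "i \<in> {c * N..<c * N + N}" "j \<in> {c * N..<c * N + N}"
    "triangle x y z i = 1" "triangle x y z j = 1"
  shows "i = j"
proof -
  obtain i' j' where ij: "i = c * N + i'" "j = c * N + j'" "i' < N" "j' < N"
    using assms(2,3) by (auto simp: nat_le_iff_add)
  have "triangle x y z (c * N + k) = of_bool (k = nat ((if c = 0 then x else if c = 1 then y else z) mod int N))"
    if "k < N" for k
  proof -
    consider "c = 0" | "c = 1" | "c = 2" using assms(1) by linarith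
    then show ?thesis using that by cases (simp_all add: triangle_X triangle_Y triangle_Z)
  qed
  then show ?thesis
    using assms(4,5) unfolding ij using ij(3,4) by (metis of_bool_eq(1) zero_neq_one)
qed

lemma triangle_part_exists:
  assumes "c < 3"
  shows "\<exists>i\<in>{c * N..<c * N + N}. triangle x y z i = 1"
proof -
  consider "c = 0" | "c = 1" | "c = 2" using assms by linarith
  then show ?thesis
  proof cases
    case 1
    then show ?thesis
      by (intro bexI[of _ "nat (x mod int N)"]) (auto simp: triangle_X nat_mod_N_less)
  next
    case 2
    then show ?thesis
      by (intro bexI[of _ "N + nat (y mod int N)"]) (auto simp: triangle_Y nat_mod_N_less)
  next
    case 3
    then show ?thesis
      by (intro bexI[of _ "2 * N + nat (z mod int N)"]) (auto simp: triangle_Z nat_mod_N_less)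
  qed
qed

section \<open>Moves applicable at \<open>vpos\<close>\<close>

context
  fixes u
  assumes u: "u \<in> graph_ker (complete_graph n)" and nn: "nonneg (vpos + u)"
begin

lemma u_pair_support:
  assumes "a \<in> labelings {..<n}" "Poly_Mapping.lookup (vpos + u) a \<noteq> 0" "i < n" "j < n" "i \<noteq> j"
  shows "\<exists>x k. tpos x k i = a i \<and> tpos x k j = a j"
proof -
  have "\<exists>t\<in>Poly_Mapping.keys vpos. t i = a i \<and> t j = a j"
    using assms vpos_lattice
    by (intro fibre_pair_support[OF u _ _ _ nn]) (auto simp: complete_graph_def)
  then show ?thesis using keys_vpos by blast
qed

lemma u_part_unique:
  assumes "a \<in> labelings {..<n}" "Poly_Mapping.lookup (vpos + u) a \<noteq> 0"
    and c: "c < 3" "i \<in> {c * N..<c * N + N}" "j \<in> {c * N..<c * N + N}" "a i = 1" "a j = 1"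
  shows "i = j"
proof (rule ccontr)
  assume "i \<noteq> j"
  then obtain x k where "tpos x k i = 1" "tpos x k j = 1"
    using u_pair_support[OF assms(1,2), of i j] part_bound[OF c(1)] c by auto
  then show False
    using \<open>i \<noteq> j\<close> triangle_part_unique[OF c(1-3)] unfolding tpos_def by blast
qed

text \<open>Pair supports allow at most one vertex in each part. That no part is missed comes from
  averaging, by \<open>fibre_part_sum\<close>: every positive triangle has exactly one vertex
  there.\<close>

lemma u_part_exists:
  assumes a: "a \<in> labelings {..<n}" "Poly_Mapping.lookup (vpos + u) a \<noteq> 0" and c: "c < 3"
  shows "\<exists>i\<in>{c * N..<c * N + N}. a i = 1"
proof -
  let ?P = "{c * N..<c * N + N}"
  have P: "?P \<subseteq> {..<n}" using part_bound[OF c] by auto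
  have le: "sum b ?P \<le> 1" if "b \<in> labelings {..<n}" "Poly_Mapping.lookup (vpos + u) b \<noteq> 0" for b
    using u_part_unique[OF that c] labelings_cases[OF that(1)] P
    by (intro sum_le_1_if_unique) (blast | simp del: One_nat_def)+
  have "sum t ?P = 1" if "t \<in> Poly_Mapping.keys vpos" for t
  proof -
    from that obtain x y z where t: "t = triangle x y z" using keys_vpos[of t] by (auto simp: tpos_def)
    have "sum t ?P \<le> 1"
      using triangle_part_unique[OF c] labelings_cases[OF triangle_in_labelings] P unfolding t
      by (intro sum_le_1_if_unique) (blast | simp del: One_nat_def)+
    moreover obtain i where "i \<in> ?P" "t i = 1" using triangle_part_exists[OF c] t by blast
    then have "1 \<le> sum t ?P" using member_le_sum[of i ?P t] by simp
    ultimately show ?thesis by simp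
  qed
  then have "sum a ?P = 1"
    using fibre_part_sum[OF u n_ge_2 P vpos_lattice nn _ _ a] le by blast
  then have "\<not> (\<forall>i\<in>?P. a i = 0)" using sum.neutral[of ?P a] by fastforce
  then show ?thesis using labelings_cases[OF a(1)] P by blast
qed

text \<open>One vertex in each part makes \<open>a\<close> a triangle; its three edges occur in
  positive triangles, and \<open>triangle_classify\<close> applies to the three differences.\<close>

lemma vpos_u_support:
  assumes a: "a \<in> labelings {..<n}" "Poly_Mapping.lookup (vpos + u) a \<noteq> 0"
  shows "\<exists>x k. a = tpos x k \<or> a = tneg x k"
proof -
  obtain i0 where i0: "i0 < N" "a i0 = 1" using u_part_exists[OF a, of 0] by auto
  obtain i1 where i1: "i1 < N" "a (N + i1) = 1"
    using u_part_exists[OF a, of 1] by (auto simp: nat_le_iff_add)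
  obtain i2 where i2: "i2 < N" "a (2 * N + i2) = 1"
    using u_part_exists[OF a, of 2] by (auto simp: nat_le_iff_add)
  define x y z where "x = int i0" and "y = int i1" and "z = int i2"
  have xyz: "i0 = nat (x mod int N)" "i1 = nat (y mod int N)" "i2 = nat (z mod int N)"
    using i0(1) i1(1) i2(1) by (simp_all add: x_def y_def z_def)
  note un = u_part_unique[OF a]
  have less: "i0 < n" "N + i1 < n" "2 * N + i2 < n" using i0(1) i1(1) i2(1) n by auto
  have eq: "a = triangle x y z"
  proof
    fix i
    consider "n \<le> i" | "i < N" | j where "j < N" "i = N + j" | j where "j < N" "i = 2 * N + j"
      | "3 * N \<le> i" "i < n"
    proof -
      consider "i < N" | "N \<le> i" "i < 2 * N" | "2 * N \<le> i" "i < 3 * N" | "3 * N \<le> i" by linarith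
      then show thesis
      proof cases
        case 2
        then show ?thesis using that(3)[of "i - N"] by simp
      next
        case 3
        then show ?thesis using that(4)[of "i - 2 * N"] by simp
      next
        case 4
        then show ?thesis using that(1) that(5) by linarith
      qed (use that in blast)
    qed
    then show "a i = triangle x y z i"
    proof cases
      case 1
      then show ?thesis using a(1) by (auto simp: labelings_def triangle_def PiE_def extensional_def)
    next
      case 2
      then have "a i = 1 \<longleftrightarrow> i = i0" using un[of 0 i i0] i0 by auto
      then show ?thesis
        using 2 labelings_cases[OF a(1), of i] n by (auto simp: triangle_X xyz(1)[symmetric])
    next
      case (3 j)
      then have "a i = 1 \<longleftrightarrow> j = i1" using un[of 1 i "N + i1"] i1 by auto
      then show ?thesis
        using 3 labelings_cases[OF a(1), of i] n by (auto simp: triangle_Y xyz(2)[symmetric])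
    next
      case (4 j)
      then have "a i = 1 \<longleftrightarrow> j = i2" using un[of 2 i "2 * N + i2"] i2 by auto
      then show ?thesis
        using 4 labelings_cases[OF a(1), of i] n by (auto simp: triangle_Z xyz(3)[symmetric])
    next
      case 5
      then obtain x' k where "tpos x' k i = a i"
        using u_pair_support[OF a, of i i0] less i0(1) N_pos by auto
      then show ?thesis using 5 by (simp add: tpos_def triangle_rest)
    qed
  qed
  \<comment> \<open>The positive triangles through the three edges need not agree, hence separate
    base points and indices.\<close>
  obtain x1 k where "tpos x1 k i0 = 1" "tpos x1 k (N + i1) = 1"
    using u_pair_support[OF a less(1,2)] i0 i1 by auto
  then have xy: "int N dvd x1 - x" "int N dvd (x1 - g k) - y"
    unfolding tpos_def xyz by (auto simp del: One_nat_def simp: triangle_at_X triangle_at_Y)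
  obtain x2 l where "tpos x2 l i0 = 1" "tpos x2 l (2 * N + i2) = 1"
    using u_pair_support[OF a less(1,3)] i0 i2 by auto
  then have xz: "int N dvd x2 - x" "int N dvd (x2 + g (Suc l)) - z"
    unfolding tpos_def xyz by (auto simp del: One_nat_def simp: triangle_at_X triangle_at_Z)
  obtain x3 m where "tpos x3 m (N + i1) = 1" "tpos x3 m (2 * N + i2) = 1"
    using u_pair_support[OF a less(2,3)] i1 i2 by auto
  then have yz: "int N dvd (x3 - g m) - y" "int N dvd (x3 + g (Suc m)) - z"
    unfolding tpos_def xyz by (auto simp del: One_nat_def simp: triangle_at_Y triangle_at_Z)
  have "int N dvd (x - y) - g k"
    using dvd_diff[OF xy(2,1)] by (simp add: algebra_simps)
  moreover have "int N dvd (z - x) - g (Suc l)"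
    using dvd_diff[OF xz] by (simp add: algebra_simps)
  moreover have "int N dvd (z - y) - (g m + g (Suc m))"
    using dvd_diff[OF yz] by (simp add: algebra_simps)
  ultimately show ?thesis unfolding eq using triangle_classify by blast
qed

lemma u_lattice: "u \<in> int_lattice {..<n}"
  using u by (simp add: graph_ker_iff complete_graph_def)

text \<open>Where \<open>vpos\<close> is nonzero the labeling is a positive triangle anyway;
  elsewhere \<open>u\<close> and \<open>vpos + u\<close> agree.\<close>

lemma u_support:
  assumes "Poly_Mapping.lookup u a \<noteq> 0"
  shows "\<exists>x k. a = tpos x k \<or> a = tneg x k"
proof (cases "Poly_Mapping.lookup vpos a = 0")
  case True
  have "a \<in> labelings {..<n}" using keys_int_lattice[OF u_lattice] assms by (auto simp: in_keys_iff)
  then show ?thesis using vpos_u_support True assms by (simp add: lookup_add)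
next
  case False
  then show ?thesis using keys_vpos[of a] by (auto simp: in_keys_iff)
qed

text \<open>As the edge lies in just one triangle of each sign, the moment of \<open>u\<close> at
  this edge has only two terms.\<close>

lemma u_edge:
  assumes "i < n" "j < n" "i \<noteq> j"
    and p: "tpos x k i = 1" "tpos x k j = 1" and q: "tneg x' k' i = 1" "tneg x' k' j = 1"
    and pos: "\<And>x'' m. tpos x'' m i = 1 \<Longrightarrow> tpos x'' m j = 1 \<Longrightarrow> tpos x'' m = tpos x k"
    and neg: "\<And>x'' m. tneg x'' m i = 1 \<Longrightarrow> tneg x'' m j = 1 \<Longrightarrow> tneg x'' m = tneg x' k'"
  shows "Poly_Mapping.lookup u (tpos x k) + Poly_Mapping.lookup u (tneg x' k') = 0"
proof -
  have "Poly_Mapping.lookup u (tpos x k) + Poly_Mapping.lookup u (tneg x' k') =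
      (\<Sum>a\<in>labelings {..<n}. Poly_Mapping.lookup u a * of_bool (a i = 1 \<and> a j = 1))"
  proof (rule sum_of_bool_two[symmetric])
    show "finite (labelings {..<n})" by (simp add: finite_labelings)
    show "tpos x k \<in> labelings {..<n}" "tneg x' k' \<in> labelings {..<n}"
      by (simp_all add: tpos_def tneg_def triangle_in_labelings)
    show "tpos x k \<noteq> tneg x' k'" by (rule tpos_neq_tneg)
    show "tpos x k i = 1 \<and> tpos x k j = 1" "tneg x' k' i = 1 \<and> tneg x' k' j = 1"
      using p q by simp_all
    fix a assume "Poly_Mapping.lookup u a \<noteq> 0" "a i = 1 \<and> a j = 1"
    then show "a = tpos x k \<or> a = tneg x' k'"
      using u_support[of a] pos neg by blast
  qed
  also have "\<dots> = 0"
    using graph_ker_pair_sum[OF u, of i j "\<lambda>p q. of_bool (p = 1 \<and> q = 1)"] assms(1-3)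
    by (auto simp: complete_graph_def)
  finally show ?thesis .
qed

section \<open>The three types of edges\<close>

lemma tpos_at:
  "tpos x k (nat (r mod int N)) = 1 \<longleftrightarrow> int N dvd x - r"
  "tpos x k (N + nat (r mod int N)) = 1 \<longleftrightarrow> int N dvd (x - g k) - r"
  "tpos x k (2 * N + nat (r mod int N)) = 1 \<longleftrightarrow> int N dvd (x + g (Suc k)) - r"
  unfolding tpos_def by (rule triangle_at_X triangle_at_Y triangle_at_Z)+

lemma tneg_at:
  "tneg x k (nat (r mod int N)) = 1 \<longleftrightarrow> int N dvd x - r"
  "tneg x k (N + nat (r mod int N)) = 1 \<longleftrightarrow> int N dvd (x - g (Suc k)) - r"
  "tneg x k (2 * N + nat (r mod int N)) = 1 \<longleftrightarrow> int N dvd (x + g k) - r"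
  unfolding tneg_def by (rule triangle_at_X triangle_at_Y triangle_at_Z)+

lemma vertices_less:
  "nat (r mod int N) < n" "N + nat (r mod int N) < n" "2 * N + nat (r mod int N) < n"
  using nat_mod_N_less[of r] n by auto

lemma vertices_neq:
  "nat (r mod int N) \<noteq> N + nat (s mod int N)"
  "nat (r mod int N) \<noteq> 2 * N + nat (s mod int N)"
  "N + nat (r mod int N) \<noteq> 2 * N + nat (s mod int N)"
  using nat_mod_N_less[of r] by auto

text \<open>The difference along the edge is a single value \<open>g (Suc k)\<close>, which fixes
  the index up to the period. The XZ edges behave likewise.\<close>

lemma u_edge_XY:
  "Poly_Mapping.lookup u (tpos x (Suc k)) + Poly_Mapping.lookup u (tneg x k) = 0"
proof (rule u_edge[OF vertices_less(1,2) vertices_neq(1), of _ _ x "x - g (Suc k)"])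
  fix x' m
  show "tpos x' m = tpos x (Suc k)"
    if "tpos x' m (nat (x mod int N)) = 1" "tpos x' m (N + nat ((x - g (Suc k)) mod int N)) = 1"
  proof (rule tpos_cong)
    show *: "int N dvd x' - x" using that by (simp only: tpos_at)
    have "int N dvd (x' - x) - ((x' - g m) - (x - g (Suc k)))"
      using that by (intro dvd_diff[OF *]) (simp only: tpos_at)
    then show "g m = g (Suc k)" by (intro g_mod_cancel) (simp add: algebra_simps)
  qed
  show "tneg x' m = tneg x k"
    if "tneg x' m (nat (x mod int N)) = 1" "tneg x' m (N + nat ((x - g (Suc k)) mod int N)) = 1"
  proof (rule tneg_cong)
    show *: "int N dvd x' - x" using that by (simp only: tneg_at)
    have "int N dvd (x' - x) - ((x' - g (Suc m)) - (x - g (Suc k)))"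
      using that by (intro dvd_diff[OF *]) (simp only: tneg_at)
    then have "g (Suc m) = g (Suc k)" by (intro g_mod_cancel) (simp add: algebra_simps)
    then show "g m = g k" by (simp only: g_Suc_eq_iff)
  qed
qed (simp_all only: tpos_at tneg_at diff_self dvd_0_right)

lemma u_edge_XZ:
  "Poly_Mapping.lookup u (tpos x k) + Poly_Mapping.lookup u (tneg x (Suc k)) = 0"
proof (rule u_edge[OF vertices_less(1,3) vertices_neq(2), of _ _ x "x + g (Suc k)"])
  fix x' m
  show "tpos x' m = tpos x k"
    if "tpos x' m (nat (x mod int N)) = 1" "tpos x' m (2 * N + nat ((x + g (Suc k)) mod int N)) = 1"
  proof (rule tpos_cong)
    show *: "int N dvd x' - x" using that by (simp only: tpos_at)
    have "int N dvd ((x' + g (Suc m)) - (x + g (Suc k))) - (x' - x)"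
      using that by (intro dvd_diff[OF _ *]) (simp only: tpos_at)
    then have "g (Suc m) = g (Suc k)" by (intro g_mod_cancel) (simp add: algebra_simps)
    then show "g m = g k" by (simp only: g_Suc_eq_iff)
  qed
  show "tneg x' m = tneg x (Suc k)"
    if "tneg x' m (nat (x mod int N)) = 1" "tneg x' m (2 * N + nat ((x + g (Suc k)) mod int N)) = 1"
  proof (rule tneg_cong)
    show *: "int N dvd x' - x" using that by (simp only: tneg_at)
    have "int N dvd ((x' + g m) - (x + g (Suc k))) - (x' - x)"
      using that by (intro dvd_diff[OF _ *]) (simp only: tneg_at)
    then show "g m = g (Suc k)" by (intro g_mod_cancel) (simp add: algebra_simps)
  qed
qed (simp_all only: tpos_at tneg_at diff_self dvd_0_right)

text \<open>Here the difference is a consecutive sum, and it determines the index by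
  \<open>consecutive_sum_inj\<close>, that is, by \<open>sidon\<close>.\<close>

lemma u_edge_YZ:
  "Poly_Mapping.lookup u (tpos (y + g k) k) + Poly_Mapping.lookup u (tneg (y + g (Suc k)) k) = 0"
proof (rule u_edge[OF vertices_less(2,3) vertices_neq(3), of _ _ y "y + g k + g (Suc k)"])
  fix x' m
  show "tpos x' m = tpos (y + g k) k"
    if "tpos x' m (N + nat (y mod int N)) = 1"
      "tpos x' m (2 * N + nat ((y + g k + g (Suc k)) mod int N)) = 1"
  proof (rule tpos_cong)
    have *: "int N dvd (x' - g m) - y" "int N dvd (x' + g (Suc m)) - (y + g k + g (Suc k))"
      using that by (simp_all only: tpos_at)
    have "int N dvd (g m + g (Suc m)) - (g k + g (Suc k))"
      using dvd_diff[OF *(2,1)] by (simp add: algebra_simps)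
    then show "g m = g k" by (intro consecutive_sum_inj g_add_mod_cancel)
    then show "int N dvd x' - (y + g k)" using *(1) by (simp add: algebra_simps)
  qed
  show "tneg x' m = tneg (y + g (Suc k)) k"
    if "tneg x' m (N + nat (y mod int N)) = 1"
      "tneg x' m (2 * N + nat ((y + g k + g (Suc k)) mod int N)) = 1"
  proof (rule tneg_cong)
    have *: "int N dvd (x' - g (Suc m)) - y" "int N dvd (x' + g m) - (y + g k + g (Suc k))"
      using that by (simp_all only: tneg_at)
    have "int N dvd (g m + g (Suc m)) - (g k + g (Suc k))"
      using dvd_diff[OF *(2,1)] by (simp add: algebra_simps)
    then show "g m = g k" by (intro consecutive_sum_inj g_add_mod_cancel)
    then have "g (Suc m) = g (Suc k)" by (simp only: g_Suc_eq_iff)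
    then show "int N dvd x' - (y + g (Suc k))" using *(1) by (simp add: algebra_simps)
  qed
qed (simp_all add: tpos_at[unfolded One_nat_def] tneg_at[unfolded One_nat_def])

text \<open>Alternating between YZ and XY edges changes \<open>k\<close> but keeps the Y vertex, so
  the coefficient of a positive triangle is a function \<open>c\<close> of that vertex. The XZ edges
  then give \<open>c\<close> enough periods to be constant.\<close>

lemma u_constant:
  obtains C where "\<And>x k. Poly_Mapping.lookup u (tpos x k) = C"
    "\<And>x k. Poly_Mapping.lookup u (tneg x k) = - C"
proof -
  define c where "c y = Poly_Mapping.lookup u (tpos (y + g 0) 0)" for y
  have c: "Poly_Mapping.lookup u (tpos (y + g k) k) = c y" for y k
  proof (induction k)
    case (Suc k)
    then show ?case using u_edge_YZ[of y k] u_edge_XY[of "y + g (Suc k)" k] by simp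
  qed (simp add: c_def)
  have pc: "Poly_Mapping.lookup u (tpos x k) = c (x - g k)" for x k
    using c[of "x - g k" k] by simp
  \<comment> \<open>Both positive triangles share an edge with
    \<open>tneg x (Suc k)\<close>.\<close>
  have shift: "c (x - g k) = c (x - g (Suc (Suc k)))" for x k
    using u_edge_XZ[of x k] u_edge_XY[of x "Suc k"] pc by simp
  \<comment> \<open>The periods \<open>g 2 - g 0\<close> and \<open>g 3 - g 1\<close> differ by 4,
    which is coprime to the odd period \<open>N\<close>.\<close>
  have "c (y + 4) = c y" for y
  proof -
    have "c (y + 4) = c (y + 4 + g 1 - g 3)"
      using shift[of "y + 4 + g 1" 1] by (simp add: numeral_3_eq_3)
    also have "y + 4 + g 1 - g 3 = y + g 0 - g 2" using step_diff by simp
    also have "c \<dots> = c y"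
      using shift[of "y + g 0" 0] by (simp add: numeral_2_eq_2)
    finally show ?thesis .
  qed
  moreover have "c (y + int N) = c y" for y
    unfolding c_def by (subst tpos_cong[of _ "y + g 0"]) auto
  moreover have "coprime (4 :: int) (int N)"
  proof -
    have "coprime (2 ^ 2 :: int) (int N)"
      unfolding coprime_power_left_iff using odd_N by simp
    then show ?thesis by simp
  qed
  ultimately have "c y = c 0" for y using periodic_constant_int by blast
  with pc have pos: "Poly_Mapping.lookup u (tpos x k) = c 0" for x k by metis
  moreover have "Poly_Mapping.lookup u (tneg x k) = - c 0" for x k
    using u_edge_XY[of x k] pos by simp
  ultimately show thesis using that by blast
qed

text \<open>There are \<open>2 * N * M\<close> different triangles, and each carries the same
  nonzero integer up to sign.\<close>

lemma u_norm:
  assumes "u \<noteq> 0"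
  shows "2 * int (N * M) \<le> l1_norm u"
proof -
  obtain C where C: "\<And>x k. Poly_Mapping.lookup u (tpos x k) = C"
    "\<And>x k. Poly_Mapping.lookup u (tneg x k) = - C"
    using u_constant by blast
  have C0: "C \<noteq> 0"
  proof
    assume "C = 0"
    then have "Poly_Mapping.lookup u a = 0" for a
      using u_support[of a] C by (cases "Poly_Mapping.lookup u a = 0") auto
    then show False using assms by (simp add: poly_mapping_eqI)
  qed
  let ?T = "(\<lambda>p. tpos (fst p) (snd p)) ` idx" and ?T' = "(\<lambda>p. tneg (fst p) (snd p)) ` idx"
  have idx_inj: "p = p'" if "p \<in> idx" "p' \<in> idx" "int N dvd fst p - fst p'" "g (snd p) = g (snd p')" for p p'
  proof -
    have "fst p = fst p'" using that(1-3) by (intro dvd_N_imp_eq) (auto simp: idx_def)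
    moreover have "snd p = snd p'" using that by (auto simp: idx_def g_eq_iff)
    ultimately show ?thesis by (simp add: prod_eq_iff)
  qed
  have card_idx: "card idx = N * M" by (simp add: idx_def)
  have card: "card ?T = N * M" "card ?T' = N * M"
    using idx_inj by (auto simp: card_image inj_on_def tpos_eq_iff tneg_eq_iff simp flip: card_idx)
  have disj: "?T \<inter> ?T' = {}" using tpos_neq_tneg by fastforce
  have fin: "finite ?T" "finite ?T'" using finite_idx by auto
  have sub: "?T \<union> ?T' \<subseteq> labelings {..<n}" by (auto simp: tpos_def tneg_def triangle_in_labelings)
  have "2 * int (N * M) * 1 \<le> 2 * int (N * M) * \<bar>C\<bar>"
    using C0 by (intro mult_left_mono) auto
  also have "\<dots> = (\<Sum>a\<in>?T \<union> ?T'. \<bar>C\<bar>)"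
    using card by (simp add: card_Un_disjoint[OF fin disj])
  also have "\<dots> = (\<Sum>a\<in>?T \<union> ?T'. \<bar>Poly_Mapping.lookup u a\<bar>)"
    using C by (intro sum.cong) auto
  also have "\<dots> \<le> (\<Sum>a\<in>labelings {..<n}. \<bar>Poly_Mapping.lookup u a\<bar>)"
    using sub by (intro sum_mono2) (auto simp: finite_labelings)
  also have "\<dots> = l1_norm u"
    using keys_int_lattice[OF u_lattice] by (intro l1_norm_superset[symmetric] finite_labelings) auto
  finally show ?thesis by simp
qed

end

lemma markov_width_complete_graph_ge: "N * M \<le> markov_width (complete_graph n)"
proof -
  have "int (N * M) \<le> int (markov_width (complete_graph n))"
    using vpos_lattice vneg_lattice vpos_nonneg vneg_nonneg graph_proj_eq vpos_neq_vneg u_norm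
    by (intro markov_width_ge[of _ vpos vneg]) (simp_all add: fst_complete_graph)
  then show ?thesis by linarith
qed

end

section \<open>Convex codes\<close>

text \<open>Among all pairs with the same \<open>E\<close>-sum, the pairs in \<open>R\<close> are the unique minimizers of the
  \<open>Q\<close>-sum. Combining \<open>E\<close> and \<open>Q\<close> into one number therefore makes \<open>R\<close>-sums unique.\<close>

definition convex_code :: "('a \<Rightarrow> nat) \<Rightarrow> ('a \<Rightarrow> nat) \<Rightarrow> 'a set \<Rightarrow> ('a \<times> 'a) set \<Rightarrow> bool" where
  "convex_code E Q A R \<longleftrightarrow> (\<forall>(k, l)\<in>R. \<forall>i\<in>A. \<forall>j\<in>A. E i + E j = E k + E l \<longrightarrow>
     Q k + Q l \<le> Q i + Q j \<and> (Q k + Q l = Q i + Q j \<longrightarrow> {i, j} = {k, l}))"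

lemma convex_codeI:
  assumes "\<And>k l i j. (k, l) \<in> R \<Longrightarrow> i \<in> A \<Longrightarrow> j \<in> A \<Longrightarrow> E i + E j = E k + E l \<Longrightarrow>
     Q k + Q l \<le> Q i + Q j \<and> (Q k + Q l = Q i + Q j \<longrightarrow> {i, j} = {k, l})"
  shows "convex_code E Q A R"
  using assms unfolding convex_code_def by blast

lemma convex_codeD:
  assumes "convex_code E Q A R" "(k, l) \<in> R" "i \<in> A" "j \<in> A" "E i + E j = E k + E l"
  shows "Q k + Q l \<le> Q i + Q j" "Q k + Q l = Q i + Q j \<Longrightarrow> {i, j} = {k, l}"
  using assms unfolding convex_code_def by blast+

text \<open>Equal pairs are included because a Gray code step leaves all digits but one in
  place.\<close>

definition near :: "nat \<Rightarrow> (nat \<times> nat) set" where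
  "near P = {(k, l). k < P \<and> l < P \<and> k \<le> Suc l \<and> l \<le> Suc k}"

lemma near_sym: "(k, l) \<in> near P \<Longrightarrow> (l, k) \<in> near P"
  by (auto simp: near_def)

lemma near_cases:
  assumes "(k, l) \<in> near P"
  obtains "k = l" | "l = Suc k" | "k = Suc l"
proof -
  have "k = l \<or> l = Suc k \<or> k = Suc l" using assms by (auto simp: near_def)
  then show thesis using that by blast
qed

text \<open>For \<open>i = k + t\<close> the excess is \<open>2 * (t * (t - 1))\<close>, which over
  the integers is non-negative and vanishes only at \<open>t = 0\<close> and
  \<open>t = 1\<close>.\<close>

lemma square_sum_ge_consecutive:
  fixes i j k :: nat
  assumes "i + j = k + Suc k"
  shows "k * k + Suc k * Suc k \<le> i * i + j * j"
    and "k * k + Suc k * Suc k = i * i + j * j \<Longrightarrow> {i, j} = {k, Suc k}"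
proof -
  define t where "t = int i - int k"
  have i: "int i = int k + t" and j: "int j = int k + 1 - t"
    using assms by (simp_all add: t_def)
  have eq: "int (i * i + j * j) - int (k * k + Suc k * Suc k) = 2 * (t * (t - 1))"
    unfolding of_nat_add of_nat_mult i j of_nat_Suc by (simp add: algebra_simps)
  have "0 \<le> t * (t - 1)"
    by (cases "t \<le> 0") (auto intro: mult_nonneg_nonneg mult_nonpos_nonpos)
  then show "k * k + Suc k * Suc k \<le> i * i + j * j" using eq by linarith
  assume "k * k + Suc k * Suc k = i * i + j * j"
  then have "t * (t - 1) = 0" using eq by linarith
  then have "t = 0 \<or> t = 1" by auto
  then show "{i, j} = {k, Suc k}" using i j assms by auto
qed

lemma square_sum_ge_double:
  fixes i j k :: nat
  assumes "i + j = k + k"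
  shows "k * k + k * k \<le> i * i + j * j"
    and "k * k + k * k = i * i + j * j \<Longrightarrow> {i, j} = {k}"
proof -
  define t where "t = int i - int k"
  have i: "int i = int k + t" and j: "int j = int k - t"
    using assms by (simp_all add: t_def)
  have eq: "int (i * i + j * j) - int (k * k + k * k) = 2 * (t * t)"
    unfolding of_nat_add of_nat_mult i j by (simp add: algebra_simps)
  have "0 \<le> t * t" by simp
  then show "k * k + k * k \<le> i * i + j * j" using eq by linarith
  assume "k * k + k * k = i * i + j * j"
  then have "t * t = 0" using eq by linarith
  then have "t = 0" by simp
  then show "{i, j} = {k}" using i j by auto
qed

lemma convex_code_square: "convex_code (\<lambda>k. k) (\<lambda>k. k * k) {..<P} (near P)"
proof (rule convex_codeI)
  fix k l i j :: nat
  assume "(k, l) \<in> near P" and s: "i + j = k + l"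
  then show "k * k + l * l \<le> i * i + j * j \<and> (k * k + l * l = i * i + j * j \<longrightarrow> {i, j} = {k, l})"
  proof (cases rule: near_cases)
    case 1
    then show ?thesis using square_sum_ge_double[of i j k] s by simp
  next
    case 2
    then show ?thesis using square_sum_ge_consecutive[of i j k] s by simp
  next
    case 3
    then show ?thesis
      using square_sum_ge_consecutive[of i j l] s by (simp add: add.commute insert_commute)
  qed
qed

lemma base_decode:
  fixes w a b c d :: nat
  assumes "w * a + b = w * c + d" "b < w" "d < w"
  shows "a = c" "b = d"
proof -
  have "(w * a + b) div w = (w * c + d) div w" "(w * a + b) mod w = (w * c + d) mod w"
    using assms(1) by simp_all
  then show "a = c" "b = d" using assms(2,3) by simp_all
qed

text \<open>Since \<open>2 * E2 b < w\<close> there are no carries, and the equation of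
  \<open>E\<close>-sums splits into the two factors. The inequalities for \<open>Q1\<close> and
  \<open>Q2\<close> add up, and equality in the sum forces equality in both.\<close>

lemma convex_code_product:
  assumes c1: "convex_code E1 Q1 A1 R1" and c2: "convex_code E2 Q2 A2 R2"
    and K: "\<And>b. b \<in> A2 \<Longrightarrow> 2 * E2 b < w" and R2: "R2 \<subseteq> A2 \<times> A2"
  shows "convex_code (\<lambda>(a, b). w * E1 a + E2 b) (\<lambda>(a, b). Q1 a + Q2 b) (A1 \<times> A2)
    {((a, b), (a', b')). (a, a') \<in> R1 \<and> (b, b') \<in> R2 \<and> (a = a' \<or> b = b')}"
proof (rule convex_codeI)
  fix k l i j :: "'a \<times> 'b"
  assume kl: "(k, l) \<in> {((a, b), (a', b')). (a, a') \<in> R1 \<and> (b, b') \<in> R2 \<and> (a = a' \<or> b = b')}"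
    and iA: "i \<in> A1 \<times> A2" and jA: "j \<in> A1 \<times> A2"
    and s': "(\<lambda>(a, b). w * E1 a + E2 b) i + (\<lambda>(a, b). w * E1 a + E2 b) j =
      (\<lambda>(a, b). w * E1 a + E2 b) k + (\<lambda>(a, b). w * E1 a + E2 b) l"
  obtain a b a' b' i1 i2 j1 j2 where eqs: "k = (a, b)" "l = (a', b')" "i = (i1, i2)" "j = (j1, j2)"
    by (cases k, cases l, cases i, cases j)
  have ij: "i1 \<in> A1" "i2 \<in> A2" "j1 \<in> A1" "j2 \<in> A2"
    and R: "(a, a') \<in> R1" "(b, b') \<in> R2" and deg: "a = a' \<or> b = b'"
    and s: "w * E1 i1 + E2 i2 + (w * E1 j1 + E2 j2) = w * E1 a + E2 b + (w * E1 a' + E2 b')"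
    using kl iA jA s' by (auto simp: eqs)
  have "w * (E1 i1 + E1 j1) + (E2 i2 + E2 j2) = w * (E1 a + E1 a') + (E2 b + E2 b')"
    using s by (simp add: algebra_simps)
  moreover have "E2 i2 + E2 j2 < w" using K[OF ij(2)] K[OF ij(4)] by linarith
  moreover have "E2 b + E2 b' < w" using K[of b] K[of b'] R(2) R2 by fastforce
  ultimately have e: "E1 i1 + E1 j1 = E1 a + E1 a'" "E2 i2 + E2 j2 = E2 b + E2 b'"
    by (rule base_decode)+
  note d1 = convex_codeD[OF c1 R(1) ij(1,3) e(1)] and d2 = convex_codeD[OF c2 R(2) ij(2,4) e(2)]
  have "{(i1, i2), (j1, j2)} = {(a, b), (a', b')}"
    if "Q1 a + Q2 b + (Q1 a' + Q2 b') = Q1 i1 + Q2 i2 + (Q1 j1 + Q2 j2)"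
  proof -
    have "{i1, j1} = {a, a'}" by (rule d1(2)) (use d1(1) d2(1) that in linarith)
    moreover have "{i2, j2} = {b, b'}" by (rule d2(2)) (use d1(1) d2(1) that in linarith)
    \<comment> \<open>Equal pairs of coordinates could still be matched crosswise; with one
      coordinate constant both matchings give the same pair.\<close>
    ultimately show ?thesis using deg by (auto simp: doubleton_eq_iff)
  qed
  then show "(\<lambda>(a, b). Q1 a + Q2 b) k + (\<lambda>(a, b). Q1 a + Q2 b) l
        \<le> (\<lambda>(a, b). Q1 a + Q2 b) i + (\<lambda>(a, b). Q1 a + Q2 b) j \<and>
      ((\<lambda>(a, b). Q1 a + Q2 b) k + (\<lambda>(a, b). Q1 a + Q2 b) l =
        (\<lambda>(a, b). Q1 a + Q2 b) i + (\<lambda>(a, b). Q1 a + Q2 b) j \<longrightarrow> {i, j} = {k, l})"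
    unfolding eqs prod.case using d1(1) d2(1) by linarith
qed

lemma convex_code_pullback:
  assumes c: "convex_code E Q A R" and h: "inj_on h B" "h ` B \<subseteq> A"
    and R': "\<And>k l. (k, l) \<in> R' \<Longrightarrow> k \<in> B \<and> l \<in> B \<and> (h k, h l) \<in> R"
  shows "convex_code (\<lambda>k. E (h k)) (\<lambda>k. Q (h k)) B R'"
proof (rule convex_codeI)
  fix k l i j
  assume kl: "(k, l) \<in> R'" and ij: "i \<in> B" "j \<in> B" and e: "E (h i) + E (h j) = E (h k) + E (h l)"
  have mem: "h i \<in> A" "h j \<in> A" "k \<in> B" "l \<in> B" "(h k, h l) \<in> R" using h ij R'[OF kl] by auto
  have "h ` {i, j} = h ` {k, l} \<longleftrightarrow> {i, j} = {k, l}"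
    using mem ij by (intro inj_on_image_eq_iff[OF h(1)]) auto
  then show "Q (h k) + Q (h l) \<le> Q (h i) + Q (h j) \<and>
      (Q (h k) + Q (h l) = Q (h i) + Q (h j) \<longrightarrow> {i, j} = {k, l})"
    using convex_codeD[OF c mem(5,1,2) e] by simp
qed

section \<open>The reflected Gray code\<close>

text \<open>The low digit runs backwards in odd blocks, so it stays put at the change of block and
  each step moves only one of the two digits, by one.\<close>

definition reflect :: "nat \<Rightarrow> nat \<Rightarrow> nat \<times> nat" where
  "reflect P k = (k div P, if even (k div P) then k mod P else P - 1 - k mod P)"

lemma reflect_in:
  assumes "P > 0" "k < d * P"
  shows "reflect P k \<in> {..<d} \<times> {..<P}"
  using assms by (auto simp: reflect_def less_mult_imp_div_less)

lemma inj_reflect: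
  assumes "P > 0"
  shows "inj (reflect P)"
proof (rule injI)
  fix k l assume eq: "reflect P k = reflect P l"
  then have d: "k div P = l div P" by (simp add: reflect_def)
  have "k mod P < P" "l mod P < P" using assms by simp_all
  then have "P - Suc (k mod P) = P - Suc (l mod P) \<Longrightarrow> k mod P = l mod P" by linarith
  then have "k mod P = l mod P" using eq d by (cases "even (l div P)") (auto simp: reflect_def)
  then show "k = l" using d by (metis div_mod_decomp)
qed

lemma reflect_Suc:
  assumes "P > 0" "Suc k < d * P"
  shows "(fst (reflect P k), fst (reflect P (Suc k))) \<in> near d \<and>
    (snd (reflect P k), snd (reflect P (Suc k))) \<in> near P \<and>
    (fst (reflect P k) = fst (reflect P (Suc k)) \<or> snd (reflect P k) = snd (reflect P (Suc k)))"
proof -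
  define a r where "a = k div P" and "r = k mod P"
  have r: "r < P" using assms by (simp add: r_def)
  have k: "reflect P k = (a, if even a then r else P - 1 - r)"
    by (simp add: reflect_def a_def r_def)
  have Sk: "reflect P (Suc k) = (if Suc r = P then (Suc a, if even a then P - 1 else 0)
      else (a, if even a then Suc r else P - 1 - Suc r))"
    by (simp add: reflect_def a_def r_def div_Suc mod_Suc)
  have "fst (reflect P k) < d" "fst (reflect P (Suc k)) < d"
    using reflect_in[of P k d] reflect_in[of P "Suc k" d] assms by (auto simp: mem_Times_iff)
  then show ?thesis
    using r unfolding k Sk by (cases "Suc r = P"; cases "even a") (auto simp: near_def)
qed

lemma reflect_near:
  assumes "P > 0" "(k, l) \<in> near (d * P)"
  shows "(fst (reflect P k), fst (reflect P l)) \<in> near d \<and>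
    (snd (reflect P k), snd (reflect P l)) \<in> near P \<and>
    (fst (reflect P k) = fst (reflect P l) \<or> snd (reflect P k) = snd (reflect P l))"
  using assms(2)
proof (cases rule: near_cases)
  case 1
  then have "k < d * P" using assms(2) by (simp add: near_def)
  then show ?thesis using 1 reflect_in[OF assms(1)] by (fastforce simp: near_def mem_Times_iff)
next
  case 2
  then show ?thesis using reflect_Suc[OF assms(1), of k d] assms(2) by (auto simp: near_def)
next
  case 3
  then have "Suc l < d * P" using assms(2) by (simp add: near_def)
  from reflect_Suc[OF assms(1) this] show ?thesis
    unfolding 3 by (metis near_sym)
qed

text \<open>Each round puts a new leading digit in front; its weight \<open>2 * K\<close> avoids
  carries and accounts for the base \<open>2 * d\<close>. The first four codewords are tracked
  because \<open>step_diff\<close> needs them explicitly.\<close>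

lemma gray_code_exists:
  assumes d: "4 \<le> d"
  shows "\<exists>E Q. convex_code E Q {..<d ^ Suc m} (near (d ^ Suc m)) \<and>
    (\<forall>k<d ^ Suc m. E k < (2 * d) ^ Suc m \<and> Q k \<le> Suc m * d\<^sup>2) \<and> (\<forall>k<4. E k = k \<and> Q k = k * k)"
proof (induction m)
  case 0
  have "k * k \<le> d * d" if "k < d" for k using that by (intro mult_mono) auto
  then show ?case
    using convex_code_square[of d] by (intro exI[of _ "\<lambda>k. k"] exI[of _ "\<lambda>k. k * k"]) (auto simp: power2_eq_square)
next
  case (Suc m)
  define P K where "P = d ^ Suc m" and "K = (2 * d) ^ Suc m"
  from Suc obtain E Q where EQ: "convex_code E Q {..<P} (near P)"
    "\<And>k. k < P \<Longrightarrow> E k < K" "\<And>k. k < P \<Longrightarrow> Q k \<le> Suc m * d\<^sup>2"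
    "\<And>k. k < 4 \<Longrightarrow> E k = k" "\<And>k. k < 4 \<Longrightarrow> Q k = k * k"
    unfolding P_def K_def by blast
  have "4 * 1 \<le> d * d ^ m" using d by (intro mult_le_mono) auto
  then have "4 \<le> P" by (simp add: P_def)
  then have P: "P > 0" "4 \<le> P" by simp_all
  let ?E = "\<lambda>(a, b). 2 * K * a + E b" and ?Q = "\<lambda>(a, b). a * a + Q b"
  have "convex_code ?E ?Q ({..<d} \<times> {..<P})
    {((a, b), (a', b')). (a, a') \<in> near d \<and> (b, b') \<in> near P \<and> (a = a' \<or> b = b')}"
    using EQ(2) by (intro convex_code_product[OF convex_code_square EQ(1)]) (auto simp: near_def)
  then have "convex_code (\<lambda>k. ?E (reflect P k)) (\<lambda>k. ?Q (reflect P k)) {..<d * P} (near (d * P))"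
  proof (rule convex_code_pullback)
    show "inj_on (reflect P) {..<d * P}" using inj_reflect[OF P(1)] inj_on_subset by blast
    show "reflect P ` {..<d * P} \<subseteq> {..<d} \<times> {..<P}" using reflect_in[OF P(1)] by blast
    fix k l assume kl: "(k, l) \<in> near (d * P)"
    then show "k \<in> {..<d * P} \<and> l \<in> {..<d * P} \<and> (reflect P k, reflect P l) \<in>
        {((a, b), (a', b')). (a, a') \<in> near d \<and> (b, b') \<in> near P \<and> (a = a' \<or> b = b')}"
      using reflect_near[OF P(1) kl] by (auto simp: near_def split: prod.split)
  qed
  moreover have "?E (reflect P k) < 2 * d * K \<and> ?Q (reflect P k) \<le> Suc (Suc m) * d\<^sup>2"
    if k: "k < d * P" for k
  proof -
    obtain a b where ab: "reflect P k = (a, b)" "a < d" "b < P"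
      using reflect_in[OF P(1) k] by (cases "reflect P k") auto
    have "2 * K * a + E b < 2 * K * Suc a" using EQ(2)[OF ab(3)] by simp
    also have "\<dots> \<le> 2 * K * d" using ab(2) by (intro mult_left_mono) auto
    finally have "2 * K * a + E b < 2 * d * K" by (simp add: mult_ac)
    moreover have "a * a \<le> d\<^sup>2" using ab(2) by (auto simp: power2_eq_square intro: mult_mono)
    ultimately show ?thesis using EQ(3)[OF ab(3)] ab(1) by simp
  qed
  \<comment> \<open>As \<open>4 \<le> P\<close>, these indices lie in block 0, which is not
    reversed.\<close>
  moreover have "?E (reflect P k) = k \<and> ?Q (reflect P k) = k * k" if "k < 4" for k
    using that P EQ(4,5) by (simp add: reflect_def)
  ultimately show ?case
    by (intro exI[of _ "\<lambda>k. ?E (reflect P k)"] exI[of _ "\<lambda>k. ?Q (reflect P k)"])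
       (simp add: P_def K_def)
qed

text \<open>Running through the Gray code once forwards and once backwards closes it into a cycle.\<close>

lemma cyclic_code_exists:
  assumes d: "4 \<le> d" and M: "M = 2 * d ^ Suc m"
  shows "\<exists>E Q. convex_code E Q {..<M} {(k, l). k < M \<and> (l = k \<or> l = Suc k mod M)} \<and>
    (\<forall>k<M. E k < 4 * (2 * d) ^ Suc m \<and> Q k \<le> Suc (Suc m) * d\<^sup>2) \<and>
    (\<forall>k<4. E k = k \<and> Q k = k * k)"
proof -
  define P K where "P = d ^ Suc m" and "K = (2 * d) ^ Suc m"
  obtain E Q where EQ: "convex_code E Q {..<P} (near P)"
    "\<And>k. k < P \<Longrightarrow> E k < K" "\<And>k. k < P \<Longrightarrow> Q k \<le> Suc m * d\<^sup>2"
    "\<And>k. k < 4 \<Longrightarrow> E k = k" "\<And>k. k < 4 \<Longrightarrow> Q k = k * k"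
    using gray_code_exists[OF d, of m] unfolding P_def K_def by blast
  have "4 * 1 \<le> d * d ^ m" using d by (intro mult_le_mono) auto
  then have "4 \<le> P" by (simp add: P_def)
  then have P: "P > 0" "4 \<le> P" by simp_all
  have M2: "M = 2 * P" by (simp add: M P_def)
  let ?E = "\<lambda>(a, b). 2 * K * a + E b" and ?Q = "\<lambda>(a, b). a * a + Q b"
  \<comment> \<open>The extra binary digit is 0 on the way forth and 1 on the way back, so both
    turning points, \<open>P - 1\<close> to \<open>P\<close> and \<open>M - 1\<close> to 0, change
    this digit only.\<close>
  let ?h = "\<lambda>k. if k < P then (0 :: nat, k) else (1, 2 * P - 1 - k)"
  have "convex_code ?E ?Q ({..<2} \<times> {..<P})
    {((a, b), (a', b')). (a, a') \<in> near 2 \<and> (b, b') \<in> near P \<and> (a = a' \<or> b = b')}"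
    using EQ(2) by (intro convex_code_product[OF convex_code_square EQ(1)]) (auto simp: near_def)
  then have "convex_code (\<lambda>k. ?E (?h k)) (\<lambda>k. ?Q (?h k)) {..<M}
    {(k, l). k < M \<and> (l = k \<or> l = Suc k mod M)}"
  proof (rule convex_code_pullback)
    show "inj_on ?h {..<M}" by (rule inj_onI) (auto simp: M2 split: if_splits)
    show "?h ` {..<M} \<subseteq> {..<2} \<times> {..<P}" by (auto simp: M2)
    fix k l assume "(k, l) \<in> {(k, l). k < M \<and> (l = k \<or> l = Suc k mod M)}"
    then have k: "k < 2 * P" and l: "l = k \<or> l = (if Suc k = 2 * P then 0 else Suc k)"
      by (auto simp: M2 mod_Suc)
    then have "k \<in> {..<M} \<and> l \<in> {..<M}" using P by (auto simp: M2)
    moreover have "(?h k, ?h l) \<in>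
        {((a, b), (a', b')). (a, a') \<in> near 2 \<and> (b, b') \<in> near P \<and> (a = a' \<or> b = b')}"
      using l
    proof
      assume "l = k"
      then show ?thesis using k by (auto simp: near_def)
    next
      assume l: "l = (if Suc k = 2 * P then 0 else Suc k)"
      consider "Suc k < P" | "Suc k = P" | "P \<le> k" "Suc k < 2 * P" | "Suc k = 2 * P"
        using k by linarith
      then show ?thesis using l P(1) by cases (auto simp: near_def)
    qed
    ultimately show "k \<in> {..<M} \<and> l \<in> {..<M} \<and> (?h k, ?h l) \<in>
        {((a, b), (a', b')). (a, a') \<in> near 2 \<and> (b, b') \<in> near P \<and> (a = a' \<or> b = b')}"
      by blast
  qed
  moreover have "?E (?h k) < 4 * K \<and> ?Q (?h k) \<le> Suc (Suc m) * d\<^sup>2" if k: "k < M" for k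
  proof -
    obtain a b where ab: "?h k = (a, b)" "a < 2" "b < P"
      using k by (cases "k < P") (auto simp: M2)
    have "2 * K * a \<le> 2 * K * 1" "a * a \<le> 1 * 1" using ab(2) by (intro mult_mono; simp)+
    moreover have "1 \<le> d\<^sup>2" using d by simp
    ultimately have "2 * K * a + E b < 4 * K" "a * a + Q b \<le> Suc (Suc m) * d\<^sup>2"
      using EQ(2,3)[OF ab(3)] unfolding mult_Suc by linarith+
    then show ?thesis unfolding ab(1) prod.case by blast
  qed
  moreover have "?E (?h k) = k \<and> ?Q (?h k) = k * k" if "k < 4" for k
    using that P EQ(4,5) by simp
  ultimately show ?thesis
    unfolding K_def[symmetric] by blast
qed

text \<open>\<open>g\<close> has \<open>E\<close> as high and \<open>Q\<close> as low digit, so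
  equal sums of two values have equal \<open>E\<close>-sums and equal \<open>Q\<close>-sums, and
  convexity identifies the pairs.\<close>

lemma triangle_cycle_exists:
  assumes d: "4 \<le> d" and N: "odd N" "24 * (m + 2) * d\<^sup>2 * (2 * d) ^ Suc m \<le> N" and n: "3 * N \<le> n"
  shows "\<exists>g. triangle_cycle g (2 * d ^ Suc m) N n"
proof -
  define M where "M = 2 * d ^ Suc m"
  define q where "q = Suc (Suc m) * d\<^sup>2"
  \<comment> \<open>Two values of \<open>Q\<close> add up to at most \<open>2 * q\<close>, hence no
    carry in base \<open>W\<close>.\<close>
  define W where "W = 2 * q + 1"
  obtain E Q where c: "convex_code E Q {..<M} {(k, l). k < M \<and> (l = k \<or> l = Suc k mod M)}"
    and E: "\<And>k. k < M \<Longrightarrow> E k < 4 * (2 * d) ^ Suc m" and Q: "\<And>k. k < M \<Longrightarrow> Q k \<le> q"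
    and small: "\<And>k. k < 4 \<Longrightarrow> E k = k" "\<And>k. k < 4 \<Longrightarrow> Q k = k * k"
    using cyclic_code_exists[OF d M_def] unfolding q_def by blast
  have "4 * 1 \<le> d * d ^ m" using d by (intro mult_le_mono) auto
  then have M4: "4 < M" by (simp add: M_def)
  define g where "g k = int (W * E (k mod M) + Q (k mod M))" for k
  have md: "k mod M < M" for k using M4 by simp
  have Qsum: "Q (i mod M) + Q (j mod M) < W" for i j
    using Q[OF md[of i]] Q[OF md[of j]] by (simp add: W_def)
  have decode: "E (i mod M) + E (j mod M) = E (k mod M) + E (l mod M)"
    "Q (i mod M) + Q (j mod M) = Q (k mod M) + Q (l mod M)"
    if "g i + g j = g k + g l" for i j k l
  proof -
    have "int (W * (E (i mod M) + E (j mod M)) + (Q (i mod M) + Q (j mod M))) =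
        int (W * (E (k mod M) + E (l mod M)) + (Q (k mod M) + Q (l mod M)))"
      using that by (simp add: g_def algebra_simps)
    then have "W * (E (i mod M) + E (j mod M)) + (Q (i mod M) + Q (j mod M)) =
        W * (E (k mod M) + E (l mod M)) + (Q (k mod M) + Q (l mod M))"
      by (simp only: of_nat_eq_iff)
    from base_decode[OF this Qsum Qsum]
    show "E (i mod M) + E (j mod M) = E (k mod M) + E (l mod M)"
      "Q (i mod M) + Q (j mod M) = Q (k mod M) + Q (l mod M)" .
  qed
  have unique: "{i mod M, j mod M} = {k mod M, l mod M}"
    if "g i + g j = g k + g l" "l mod M = k mod M \<or> l mod M = Suc k mod M" for i j k l
    using that decode[OF that(1)] md by (intro convex_codeD(2)[OF c]) (auto simp: mod_Suc_eq)
  have g_eq: "g i = g j" if "i mod M = j mod M" for i j using that by (simp add: g_def)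
  have "triangle_cycle g M N n"
  proof
    show "3 \<le> M" using M4 by simp
    show "g i = g j \<longleftrightarrow> i mod M = j mod M" for i j
    proof
      assume "g i = g j"
      then show "i mod M = j mod M" using unique[of i j j j] by auto
    qed (rule g_eq)
    show "0 \<le> g k" for k by (simp add: g_def)
    show "2 * g k < int N" for k
    proof -
      \<comment> \<open>The constant 24 is 2 * 4 * 3: the doubling, the factor in the bound on
        \<open>E\<close>, and \<open>W \<le> 3 * q\<close>.\<close>
      have "W * E (k mod M) + Q (k mod M) < W * Suc (E (k mod M))"
        using Qsum[of k k] by simp
      also have "\<dots> \<le> W * (4 * (2 * d) ^ Suc m)"
        using E[OF md[of k]] by (intro mult_le_mono) auto
      finally have "2 * (W * E (k mod M) + Q (k mod M)) < 8 * (W * (2 * d) ^ Suc m)" by simp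
      also have "\<dots> \<le> 8 * (3 * q * (2 * d) ^ Suc m)"
      proof -
        have "1 \<le> d\<^sup>2" using d by simp
        then have "1 \<le> q" by (simp add: q_def)
        then have "W \<le> 3 * q" by (simp add: W_def)
        then show ?thesis by (intro mult_le_mono) auto
      qed
      also have "\<dots> = 24 * (m + 2) * d\<^sup>2 * (2 * d) ^ Suc m" by (simp add: q_def algebra_simps)
      finally have "2 * (W * E (k mod M) + Q (k mod M)) < N" using N(2) by linarith
      then have "int (2 * (W * E (k mod M) + Q (k mod M))) < int N" by (simp only: of_nat_less_iff)
      then show ?thesis by (simp add: g_def)
    qed
    show "(g i = g k \<and> g j = g (Suc k)) \<or> (g i = g (Suc k) \<and> g j = g k)"
      if "g i + g j = g k + g (Suc k)" for i j k
    proof -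
      have "{i mod M, j mod M} = {k mod M, Suc k mod M}" by (rule unique[OF that]) simp
      then show ?thesis unfolding doubleton_eq_iff using g_eq by blast
    qed
    show "odd N" by (rule N(1))
    \<comment> \<open>In \<open>W * k + k * k\<close> the linear part cancels from the difference of
      differences, and the squares leave (9 - 1) - (4 - 0) = 4.\<close>
    have "g k = int (W * k + k * k)" if "k < 4" for k
    proof -
      have "k mod M = k" using that M4 by (intro mod_less) linarith
      then show ?thesis unfolding g_def by (simp only: small[OF that])
    qed
    from this[of 0] this[of 1] this[of 2] this[of 3]
    show "g 3 - g 1 = g 2 - g 0 + 4" by simp
    show "3 * N \<le> n" by (rule n)
  qed
  then show ?thesis unfolding M_def by blast
qed

section \<open>Asymptotics\<close>

lemma markov_width_complete_graph_lower:
  assumes "4 \<le> d" "odd N" "24 * (m + 2) * d\<^sup>2 * (2 * d) ^ Suc m \<le> N" "3 * N \<le> n"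
  shows "N * (2 * d ^ Suc m) \<le> markov_width (complete_graph n)"
  using triangle_cycle_exists[OF assms] triangle_cycle.markov_width_complete_graph_ge by blast

lemma eventually_powr_ge:
  fixes s A :: real
  assumes "s > 0"
  shows "\<exists>n0::nat. \<forall>n\<ge>n0. A \<le> real n powr s"
proof (intro exI allI impI)
  fix n :: nat
  assume n: "nat \<lceil>max A 1 powr (1 / s)\<rceil> \<le> n"
  then have "max A 1 powr (1 / s) \<le> real n" by linarith
  then have "(max A 1 powr (1 / s)) powr s \<le> real n powr s"
    using assms by (intro powr_mono2) auto
  then show "A \<le> real n powr s" using assms by (simp add: powr_powr)
qed

theorem theorem9:
  fixes \<epsilon> :: real
  assumes "\<epsilon> > 0"
  shows "\<exists>n0::nat. \<forall>n\<ge>n0. real (markov_width (complete_graph n)) \<ge> real n powr (2 - \<epsilon>)"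
proof -
  \<comment> \<open>With \<open>d\<close> about \<open>n powr \<delta>\<close>, the size condition
    costs \<open>d ^ (m + 3)\<close>, about \<open>n powr (1 - \<delta>)\<close>, which leaves a
    factor \<open>n powr \<delta>\<close> for constants. The width is about
    \<open>n * d ^ Suc m\<close>, of exponent \<open>2 - 3 * \<delta>\<close>, and the choice of
    \<open>m\<close> makes \<open>3 * \<delta> < \<epsilon>\<close>.\<close>
  obtain m :: nat where m: "3 / \<epsilon> < real m" using reals_Archimedean2 by blast
  define \<delta> where "\<delta> = 1 / (real m + 4)"
  have \<delta>: "0 < \<delta>" "\<delta> < 1" "real (m + 3) * \<delta> = 1 - \<delta>" "real (Suc m) * \<delta> = 1 - 3 * \<delta>"
    by (simp_all add: \<delta>_def field_simps)
  have "3 * \<delta> < \<epsilon>" using m assms by (simp add: \<delta>_def field_simps)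
  define A where "A = real (24 * (m + 2) * 2 ^ Suc m)"
  \<comment> \<open>The 8 ensures \<open>4 \<le> d\<close> and that rounding down loses at most a
    factor 2; \<open>4 * A\<close> absorbs the constants of the size condition, given
    \<open>n / 4 \<le> N\<close>.\<close>
  obtain n1 where n1: "\<And>n. n \<ge> n1 \<Longrightarrow> max 8 (4 * A) \<le> real n powr \<delta>"
    using eventually_powr_ge[OF \<delta>(1)] by blast
  \<comment> \<open>The constant is the total loss: 4 from \<open>N\<close> and
    \<open>2 ^ Suc m\<close> from halving \<open>x\<close>, against the gain 2 in the length of the
    cycle.\<close>
  obtain n2 where n2: "\<And>n. n \<ge> n2 \<Longrightarrow> 2 * 2 ^ Suc m \<le> real n powr (\<epsilon> - 3 * \<delta>)"
    using eventually_powr_ge[of "\<epsilon> - 3 * \<delta>" "2 * 2 ^ Suc m"] \<open>3 * \<delta> < \<epsilon>\<close> by auto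
  show ?thesis
  proof (intro exI allI impI)
    fix n assume "max (max n1 n2) 24 \<le> n"
    then have n: "n1 \<le> n" "n2 \<le> n" "24 \<le> n" by simp_all
    define x where "x = real n powr \<delta>"
    define d where "d = nat \<lfloor>x\<rfloor>"
    \<comment> \<open>The largest odd number with \<open>3 * N \<le> n\<close>.\<close>
    define N where "N = (if odd (n div 3) then n div 3 else n div 3 - 1)"
    have x: "8 \<le> x" "4 * A \<le> x" using n1[OF n(1)] by (simp_all add: x_def)
    have d: "real d \<le> x" "x - 1 < real d" using x(1) unfolding d_def by linarith+
    then have d4: "4 \<le> d" and dx: "x / 2 \<le> real d" using x(1) by linarith+
    have xp: "x ^ k = real n powr (real k * \<delta>)" for k
      using n(3) by (simp add: x_def powr_realpow[symmetric] powr_powr mult.commute)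
    have N: "odd N" "3 * N \<le> n" "real n / 4 \<le> real N"
    proof -
      have "8 \<le> n div 3" using n(3) by linarith
      then show "odd N" by (auto simp: N_def)
      have "N \<le> n div 3" "n div 3 \<le> Suc N" by (auto simp: N_def)
      then show "3 * N \<le> n" by linarith
      have "n \<le> 4 * N" using \<open>n div 3 \<le> Suc N\<close> n(3) by linarith
      then show "real n / 4 \<le> real N" by linarith
    qed
    have "real (24 * (m + 2) * d\<^sup>2 * (2 * d) ^ Suc m) = A * real d ^ (m + 3)"
      by (simp add: A_def power_mult_distrib power_add power2_eq_square power3_eq_cube)
    also have "\<dots> \<le> A * x ^ (m + 3)"
      using d(1) by (intro mult_left_mono power_mono) (auto simp: A_def)
    also have "\<dots> = A * real n powr (1 - \<delta>)" by (simp only: xp \<delta>(3))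
    also have "\<dots> \<le> x / 4 * real n powr (1 - \<delta>)"
      using x(2) by (intro mult_right_mono) auto
    also have "\<dots> = real n / 4"
      using n(3) by (simp add: x_def powr_add[symmetric])
    finally have "real (24 * (m + 2) * d\<^sup>2 * (2 * d) ^ Suc m) \<le> real N" using N(3) by linarith
    then have "24 * (m + 2) * d\<^sup>2 * (2 * d) ^ Suc m \<le> N" by (simp only: of_nat_le_iff)
    from markov_width_complete_graph_lower[OF d4 N(1) this N(2)]
    have low: "real (N * (2 * d ^ Suc m)) \<le> real (markov_width (complete_graph n))"
      by (simp only: of_nat_le_iff)
    have "real n powr (2 - \<epsilon>) * (2 * 2 ^ Suc m) \<le> real n powr (2 - \<epsilon>) * real n powr (\<epsilon> - 3 * \<delta>)"
      using n2[OF n(2)] by (intro mult_left_mono) auto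
    also have "\<dots> = real n powr (1 + (1 - 3 * \<delta>))" by (simp add: powr_add[symmetric])
    also have "\<dots> = real n powr 1 * real n powr (1 - 3 * \<delta>)" by (rule powr_add)
    also have "\<dots> = real n * x ^ Suc m"
      by (simp only: xp \<delta>(4) powr_one[OF of_nat_0_le_iff])
    finally have "real n powr (2 - \<epsilon>) \<le> real n / 4 * (2 * (x / 2) ^ Suc m)"
      by (simp add: field_simps power_divide)
    also have "\<dots> \<le> real N * (2 * real d ^ Suc m)"
      using N(3) dx x(1) by (intro mult_mono power_mono mult_left_mono) auto
    also have "\<dots> = real (N * (2 * d ^ Suc m))" by simp
    finally show "real (markov_width (complete_graph n)) \<ge> real n powr (2 - \<epsilon>)"
      using low by linarith
  qed
qed

end
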